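(* Let $u$ be a continuous real-valued function defined on a domain $\Omega\subset\mathbb{R}^n$, and assume that for some $\kappa$ satisfying $$0<\kappa\le\kappa_1:=-\frac{n}{4}+\frac12\sqrt{\frac{n^2}{4}+2n}$$ the inequality $$\frac{1}{|\partial B(a,\kappa r)|}\int_{\partial B(a,\kappa r)}u(x)\,ds\;\le\;\frac{1}{|B(a,r)|}\int_{B(a,r)}u(x)\,dx$$ is satisfied for all balls $B(a,r)$ whose closure is contained in $\Omega$. Then $u$ is subharmonic in $\Omega$.
   Context: $n\ge1$. $B(a,r)$ denotes the open ball in $\mathbb{R}^n$ with centre $a$ and radius $r>0$; $|B(a,r)|$ is its volume, $|\partial B(a,r)|$ the surface measure of its boundary, and $ds$ surface measure (for $n=1$ the spherical average is the average over the two endpoints). A real-valued function $u$ defined in $\Omega$ is called subharmonic if $u$ is continuous and for every ball $B$ whose closure is contained in $\Omega$ and every function $h$ harmonic in $B$ (continuous up to $\partial B$) satisfying $h\ge u$ on $\partial B$, one has $h\ge u$ in $B$. *)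

theory Defs
  imports "HOL-Analysis.Analysis"
begin

text \<open>
  Surface measure on the sphere with centre \<open>a\<close> and radius \<open>r > 0\<close>, in the usual form
  \<open>\<sigma>(A) = (n / r) * vol (cone over A)\<close>, where the cone over \<open>A\<close> consists of the points
  \<open>x \<noteq> a\<close> of the ball whose radial projection from \<open>a\<close> to the sphere lies in \<open>A\<close>. It is a Borel
  measure on the whole space that lives on the sphere. For \<open>n = 1\<close> it is counting measure on the
  two endpoints.
\<close>

definition surface_measure :: "'a::euclidean_space \<Rightarrow> real \<Rightarrow> 'a measure" where
  "surface_measure a r =
     scale_measure (ennreal (real DIM('a) / r))
       (distr (restrict_space lborel (ball a r - {a})) borel
          (\<lambda>x. a + (r / norm (x - a)) *\<^sub>R (x - a)))"

lemma emeasure_surface_measure: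
  fixes a :: "'a::euclidean_space"
  assumes "A \<in> sets borel"
  shows "emeasure (surface_measure a r) A =
    ennreal (real DIM('a) / r) *
    emeasure lborel {x \<in> ball a r - {a}. a + (r / norm (x - a)) *\<^sub>R (x - a) \<in> A}"
proof -
  let ?p = "\<lambda>x. a + (r / norm (x - a)) *\<^sub>R (x - a)"
  have *: "?p \<in> restrict_space lborel (ball a r - {a}) \<rightarrow>\<^sub>M borel"
    by (intro measurable_restrict_space1) measurable
  have "?p -` A \<inter> space (restrict_space lborel (ball a r - {a}))
      = {x \<in> ball a r - {a}. ?p x \<in> A}"
    by (auto simp: space_restrict_space)
  moreover have "emeasure (restrict_space lborel (ball a r - {a})) {x \<in> ball a r - {a}. ?p x \<in> A}
      = emeasure lborel {x \<in> ball a r - {a}. ?p x \<in> A}"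
    by (rule emeasure_restrict_space) auto
  ultimately show ?thesis
    using assms * by (simp only: surface_measure_def emeasure_scale_measure emeasure_distr)
qed

lemma measure_surface_measure_sphere:
  fixes a :: "'a::euclidean_space"
  assumes "r > 0"
  shows "measure (surface_measure a r) (sphere a r) =
    real DIM('a) * unit_ball_vol (real DIM('a)) * r ^ (DIM('a) - 1)"
proof -
  have eq: "{x \<in> ball a r - {a}. a + (r / norm (x - a)) *\<^sub>R (x - a) \<in> sphere a r} = ball a r - {a}"
    using assms by (auto simp: dist_norm)
  have "measure lborel (ball a r - {a}) = measure lborel (ball a r)"
    unfolding measure_def by (subst emeasure_Diff_null_set) auto
  then have "measure lborel (ball a r - {a}) = unit_ball_vol (real DIM('a)) * r ^ DIM('a)"
    using assms by (simp add: content_ball)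
  moreover have "measure (surface_measure a r) (sphere a r) =
      real DIM('a) / r * measure lborel (ball a r - {a})"
    using assms
    by (simp only: measure_def emeasure_surface_measure borel_closed closed_sphere eq)
      (simp add: enn2real_mult)
  ultimately show ?thesis
    using assms by (simp add: power_eq_if)
qed

lemma emeasure_surface_measure_real:
  fixes a r :: real
  assumes "r > 0" "A \<in> sets borel"
  shows "emeasure (surface_measure a r) A = indicator A (a - r) + indicator A (a + r)"
proof -
  let ?L = "if a - r \<in> A then {a - r<..<a} else {}"
  let ?R = "if a + r \<in> A then {a<..<a + r} else {}"
  have eq: "{x \<in> ball a r - {a}. a + (r / norm (x - a)) *\<^sub>R (x - a) \<in> A} = ?L \<union> ?R"
  proof (rule set_eqI)
    fix x
    consider "x < a" | "x = a" | "x > a" by linarith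
    then show "x \<in> {x \<in> ball a r - {a}. a + (r / norm (x - a)) *\<^sub>R (x - a) \<in> A} \<longleftrightarrow> x \<in> ?L \<union> ?R"
    proof cases
      case 1
      then have "a + (r / norm (x - a)) *\<^sub>R (x - a) = a - r"
        by (simp add: field_simps)
      with 1 show ?thesis by (auto simp: dist_real_def)
    next
      case 3
      then have "a + (r / norm (x - a)) *\<^sub>R (x - a) = a + r"
        by (simp add: field_simps)
      with 3 show ?thesis by (auto simp: dist_real_def)
    qed auto
  qed
  have "emeasure lborel (?L \<union> ?R) = emeasure lborel ?L + emeasure lborel ?R"
    by (rule plus_emeasure[symmetric]) auto
  then show ?thesis
    using assms
    by (simp only: emeasure_surface_measure eq distrib_left)
      (auto simp flip: ennreal_mult)
qed

definition sphere_average :: "('a::euclidean_space \<Rightarrow> real) \<Rightarrow> 'a \<Rightarrow> real \<Rightarrow> real" where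
  "sphere_average u a r =
     1 / measure (surface_measure a r) (sphere a r) *
     (LINT x:sphere a r|surface_measure a r. u x)"

definition ball_average :: "('a::euclidean_space \<Rightarrow> real) \<Rightarrow> 'a \<Rightarrow> real \<Rightarrow> real" where
  "ball_average u a r = 1 / measure lborel (ball a r) * (LINT x:ball a r|lborel. u x)"

definition partial_deriv :: "'a::euclidean_space \<Rightarrow> ('a \<Rightarrow> real) \<Rightarrow> 'a \<Rightarrow> real" where
  "partial_deriv b f x = frechet_derivative f (at x) b"

definition C2_on :: "('a::euclidean_space \<Rightarrow> real) \<Rightarrow> 'a set \<Rightarrow> bool" where
  "C2_on f S \<longleftrightarrow>
     (\<forall>x\<in>S. f differentiable (at x)) \<and>
     (\<forall>b\<in>Basis. \<forall>x\<in>S. partial_deriv b f differentiable (at x)) \<and>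
     (\<forall>b\<in>Basis. \<forall>c\<in>Basis. continuous_on S (partial_deriv c (partial_deriv b f)))"

definition laplacian :: "('a::euclidean_space \<Rightarrow> real) \<Rightarrow> 'a \<Rightarrow> real" where
  "laplacian f x = (\<Sum>b\<in>Basis. partial_deriv b (partial_deriv b f) x)"

text \<open>Meant for open \<open>S\<close> only.\<close>

definition harmonic_on :: "('a::euclidean_space \<Rightarrow> real) \<Rightarrow> 'a set \<Rightarrow> bool" where
  "harmonic_on f S \<longleftrightarrow> C2_on f S \<and> (\<forall>x\<in>S. laplacian f x = 0)"

definition subharmonic_on :: "('a::euclidean_space \<Rightarrow> real) \<Rightarrow> 'a set \<Rightarrow> bool" where
  "subharmonic_on u \<Omega> \<longleftrightarrow>
     continuous_on \<Omega> u \<and>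
     (\<forall>a r h. r > 0 \<and> cball a r \<subseteq> \<Omega> \<and>
        harmonic_on h (ball a r) \<and> continuous_on (cball a r) h \<and>
        (\<forall>x\<in>sphere a r. u x \<le> h x) \<longrightarrow>
        (\<forall>x\<in>ball a r. u x \<le> h x))"

definition kappa1 :: "nat \<Rightarrow> real" where
  "kappa1 n = - real n / 4 + 1 / 2 * sqrt ((real n)\<^sup>2 / 4 + 2 * real n)"

end

theory Submission
  imports Defs
begin

text \<open>
  In terms of integrals over the unit ball \<open>B\<close> of \<open>\<real>\<^sup>n\<close>, the hypothesis says that
  \<open>\<integral>\<^sub>B u (c + \<kappa> r sgn z) dz \<le> \<integral>\<^sub>B u (c + r z) dz\<close>, because the spherical average is
  obtained by projecting \<open>B\<close> radially onto the sphere. Both sides are linear in \<open>u\<close> and commute with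
  translations, so the inequality passes from \<open>u\<close> to every mollification \<open>U\<close> of \<open>u\<close> with a
  nonnegative kernel, by Fubini's theorem. For the smooth function \<open>U\<close>, Taylor expansion of the two
  sides up to \<open>o(r\<^sup>2)\<close> together with the second moments
  \<open>\<integral>\<^sub>B z\<^sub>b z\<^sub>c dz = \<delta>\<^sub>b\<^sub>c |B| / (n + 2)\<close> and \<open>\<integral>\<^sub>B (sgn z)\<^sub>b (sgn z)\<^sub>c dz = \<delta>\<^sub>b\<^sub>c |B| / n\<close>
  turns it into \<open>0 \<le> (n / (n + 2) - \<kappa>\<^sup>2) \<Delta>U\<close>. The bound \<open>\<kappa> \<le> \<kappa>\<^sub>1\<close> says that
  \<open>2 \<kappa>\<^sup>2 + n \<kappa> \<le> n\<close>; since \<open>\<kappa>\<^sup>2 < \<kappa>\<close>, this forces \<open>(n + 2) \<kappa>\<^sup>2 < n\<close>, so the factor is positive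
  and \<open>\<Delta>U \<ge> 0\<close>.

  A function with nonnegative Laplacian lies below every harmonic function that dominates it on the
  boundary of a ball: otherwise the difference, perturbed by a small multiple of \<open>|x - a|\<^sup>2\<close>, would have
  an interior maximum at which its Laplacian is positive. Finally \<open>U\<close> is uniformly close to \<open>u\<close> on the
  ball in question, so the comparison is inherited by \<open>u\<close>. The three main steps are
  \<open>trace_nonneg_of_average_inequality\<close>, \<open>mollify_average_inequality\<close> and \<open>harmonic_comparison\<close>.
\<close>

section \<open>The bound on the ratio of the radii\<close>

lemma kappa1_square_bound:
  fixes \<kappa> :: real and n :: nat
  assumes "n \<ge> 1" "0 < \<kappa>" "\<kappa> \<le> kappa1 n"
  shows "\<kappa>\<^sup>2 < real n / (real n + 2)" and "\<kappa> < 1"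
proof -
  define m where "m = real n"
  have m: "m \<ge> 1" using assms(1) by (simp add: m_def)
  have "2 * \<kappa> + m / 2 \<le> sqrt (m\<^sup>2 / 4 + 2 * m)"
    using assms(3) by (simp add: kappa1_def m_def)
  then have "(2 * \<kappa> + m / 2)\<^sup>2 \<le> m\<^sup>2 / 4 + 2 * m"
    using assms(2) m by (simp add: real_le_rsqrt sqrt_ge_absD)
  then have quad: "2 * \<kappa>\<^sup>2 + m * \<kappa> \<le> m"
    by (simp add: power2_eq_square field_simps)
  show "\<kappa> < 1"
  proof (rule ccontr)
    assume "\<not> \<kappa> < 1"
    then have "m * \<kappa> \<ge> m * 1" using m by (intro mult_left_mono) auto
    moreover have "\<kappa>\<^sup>2 > 0" using assms(2) by simp
    ultimately show False using quad by simp
  qed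
  then have "\<kappa>\<^sup>2 < \<kappa>" using assms(2) by (simp add: power2_eq_square)
  then have "m * \<kappa>\<^sup>2 < m * \<kappa>" using m by simp
  then have "(m + 2) * \<kappa>\<^sup>2 < m" using quad by (simp add: algebra_simps)
  then show "\<kappa>\<^sup>2 < real n / (real n + 2)"
    using m by (simp add: m_def field_simps)
qed

section \<open>Averages as integrals over the unit ball\<close>

lemma lborel_integral_affine:
  fixes f :: "'a::euclidean_space \<Rightarrow> real"
  assumes "f \<in> borel_measurable borel" "c \<noteq> 0"
  shows "(LINT x|lborel. f x) = \<bar>c\<bar> ^ DIM('a) * (LINT x|lborel. f (t + c *\<^sub>R x))"
proof -
  have "(LINT x|lborel. f x) =
      (LINT x|density (distr lborel borel (\<lambda>x. t + c *\<^sub>R x)) (\<lambda>_. \<bar>c\<bar>^DIM('a)). f x)"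
    using lborel_affine[of c t] assms(2) by simp
  also have "\<dots> = \<bar>c\<bar> ^ DIM('a) * (LINT x|lborel. f (t + c *\<^sub>R x))"
    using assms by (subst integral_density) (auto simp: integral_distr)
  finally show ?thesis .
qed

lemma integral_scale_measure:
  fixes f :: "'a \<Rightarrow> real"
  assumes "f \<in> borel_measurable M" "c \<ge> 0"
  shows "(LINT x|scale_measure (ennreal c) M. f x) = c * (LINT x|M. f x)"
proof -
  have "scale_measure (ennreal c) M = density M (\<lambda>_. ennreal c)"
    by (rule measure_eqI) (auto simp: emeasure_density nn_integral_cmult_indicator)
  then show ?thesis
    using assms by (simp add: integral_density)
qed

lemma borel_measurable_sgn_vector [measurable]:
  "(sgn :: 'a::euclidean_space \<Rightarrow> 'a) \<in> borel_measurable borel"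
  unfolding sgn_div_norm by measurable

lemma ball_average_eq:
  fixes u :: "'a::euclidean_space \<Rightarrow> real"
  assumes "r > 0" "continuous_on (ball a r) u"
  shows "ball_average u a r =
    (LINT z:ball 0 1|lborel. u (a + r *\<^sub>R z)) / unit_ball_vol (real DIM('a))"
proof -
  have "(LINT x:ball a r|lborel. u x) =
      r ^ DIM('a) * (LINT z|lborel. indicator (ball a r) (a + r *\<^sub>R z) * u (a + r *\<^sub>R z))"
    unfolding set_lebesgue_integral_def
    using borel_measurable_continuous_on_indicator[OF _ assms(2)] assms(1)
    by (subst lborel_integral_affine[where c=r and t=a]) auto
  also have "(\<lambda>z. indicator (ball a r) (a + r *\<^sub>R z) :: real) = indicator (ball 0 1)"
    using assms(1) by (auto simp: fun_eq_iff indicator_def dist_norm)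
  finally show ?thesis
    using assms(1) unfolding ball_average_def set_lebesgue_integral_def
    by (simp add: content_ball)
qed

text \<open>
  The surface measure is a push-forward of Lebesgue measure under the radial projection, so the
  change of variables \<open>x = a + r z\<close> reduces the spherical average to the unit ball as well. At
  \<open>z = 0\<close>, where \<open>sgn z = 0\<close>, the integrand is \<open>u a\<close> instead of a value on the sphere; one point is
  negligible.
\<close>

lemma sphere_average_eq:
  fixes u :: "'a::euclidean_space \<Rightarrow> real"
  assumes "r > 0" "continuous_on (sphere a r) u"
  shows "sphere_average u a r =
    (LINT z:ball 0 1|lborel. u (a + r *\<^sub>R sgn z)) / unit_ball_vol (real DIM('a))"
proof -
  let ?p = "\<lambda>x::'a. a + (r / norm (x - a)) *\<^sub>R (x - a)"
  define f where "f = (\<lambda>x. indicator (sphere a r) x *\<^sub>R u x)"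
  have f [measurable]: "f \<in> borel_measurable borel"
    unfolding f_def using assms(2) by (intro borel_measurable_continuous_on_indicator) auto
  have f_eq: "f (a + r *\<^sub>R sgn z) = u (a + r *\<^sub>R sgn z)" if "z \<noteq> 0" for z
    using that assms(1) by (simp add: f_def dist_norm norm_sgn)
  have p: "?p \<in> restrict_space lborel (ball a r - {a}) \<rightarrow>\<^sub>M borel"
    by (intro measurable_restrict_space1) measurable
  have fp [measurable]: "(\<lambda>x. f (?p x)) \<in> borel_measurable borel"
    by measurable
  have meas: "(\<lambda>x. indicator (ball a r - {a}) x *\<^sub>R f (?p x)) \<in> borel_measurable borel"
    using fp by (intro borel_measurable_scaleR borel_measurable_indicator) auto
  have "(LINT x:sphere a r|surface_measure a r. u x) =
      DIM('a) / r * (LINT x|distr (restrict_space lborel (ball a r - {a})) borel ?p. f x)"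
    unfolding set_lebesgue_integral_def surface_measure_def f_def[symmetric]
    using assms(1) by (subst integral_scale_measure) (simp_all flip: f_def)
  also have "(LINT x|distr (restrict_space lborel (ball a r - {a})) borel ?p. f x) =
      (LINT x|lborel. indicator (ball a r - {a}) x *\<^sub>R f (?p x))"
    using p by (subst integral_distr) (simp_all add: integral_restrict_space)
  also have "\<dots> = r ^ DIM('a) *
      (LINT z|lborel. indicator (ball a r - {a}) (a + r *\<^sub>R z) *\<^sub>R f (?p (a + r *\<^sub>R z)))"
    using assms(1) lborel_integral_affine[OF meas, of r a] by simp
  also have "(LINT z|lborel. indicator (ball a r - {a}) (a + r *\<^sub>R z) *\<^sub>R f (?p (a + r *\<^sub>R z)))
      = (LINT z:ball 0 1|lborel. u (a + r *\<^sub>R sgn z))"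
    unfolding set_lebesgue_integral_def
  proof (rule Bochner_Integration.integral_cong_AE)
    show "AE z in lborel. indicator (ball a r - {a}) (a + r *\<^sub>R z) *\<^sub>R f (?p (a + r *\<^sub>R z)) =
        indicator (ball 0 1) z *\<^sub>R u (a + r *\<^sub>R sgn z)"
      using AE_lborel_singleton[of 0]
    proof eventually_elim
      case (elim z)
      have "?p (a + r *\<^sub>R z) = a + r *\<^sub>R sgn z"
        using elim assms(1) by (auto simp: sgn_div_norm divide_inverse)
      moreover have "a + r *\<^sub>R z \<in> ball a r - {a} \<longleftrightarrow> z \<in> ball 0 1"
        using elim assms(1) by (auto simp: dist_norm)
      ultimately show ?case using elim by (auto simp: indicator_def f_eq)
    qed
    show "(\<lambda>z. indicator (ball a r - {a}) (a + r *\<^sub>R z) *\<^sub>R f (?p (a + r *\<^sub>R z)))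
        \<in> borel_measurable lborel"
      using measurable_compose[OF _ meas, of "\<lambda>z. a + r *\<^sub>R z" lborel] by simp
    have "(\<lambda>z. f (a + r *\<^sub>R sgn z)) \<in> borel_measurable borel"
      using f by measurable
    then have "(\<lambda>z. if z \<in> {0} then u a else f (a + r *\<^sub>R sgn z)) \<in> borel_measurable borel"
      by (intro measurable_If_set) auto
    also have "(\<lambda>z. if z \<in> {0} then u a else f (a + r *\<^sub>R sgn z)) = (\<lambda>z. u (a + r *\<^sub>R sgn z))"
      by (auto simp: fun_eq_iff f_eq)
    finally show "(\<lambda>z. indicator (ball 0 1) z *\<^sub>R u (a + r *\<^sub>R sgn z)) \<in> borel_measurable lborel"
      by (intro borel_measurable_scaleR borel_measurable_indicator) auto
  qed
  finally have "(LINT x:sphere a r|surface_measure a r. u x) = DIM('a) / r * (r ^ DIM('a) *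
      (LINT z:ball 0 1|lborel. u (a + r *\<^sub>R sgn z)))" .
  moreover have "r ^ DIM('a) = r ^ (DIM('a) - 1) * r"
    by (rule power_minus_mult[symmetric]) simp
  moreover have "1 / (d * w * p) * (d / r * (p * r * I)) = I / w"
    if "d > 0" "w > 0" "p > 0" for d w p I :: real
    using that assms(1) by (simp add: field_simps)
  ultimately show ?thesis
    using assms(1) unfolding sphere_average_def measure_surface_measure_sphere[OF assms(1)]
    by (simp only:) simp
qed

section \<open>Moments of the unit ball\<close>

text \<open>
  The moments follow from invariance under two kinds of reflections: those that change the sign of
  one coordinate, and those that swap two coordinates (reflections along \<open>b - c\<close>). Both map boxes to
  boxes, which makes the invariance of Lebesgue measure elementary.
\<close>

lemma lborel_distr_reflect:
  fixes b :: "'a::euclidean_space"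
  assumes "b \<in> Basis"
  shows "distr lborel borel (\<lambda>x. x - (2 * (x \<bullet> b)) *\<^sub>R b) = lborel"
proof -
  let ?c = "\<lambda>j::'a. if j = b then -1 else 1 :: real"
  have "(\<Sum>j\<in>Basis. (?c j * (x \<bullet> j)) *\<^sub>R j) = x - (2 * (x \<bullet> b)) *\<^sub>R b" for x :: 'a
    by (rule euclidean_eqI) (use assms in \<open>auto simp: inner_simps inner_Basis\<close>)
  moreover have "(\<Prod>j\<in>Basis. \<bar>?c j\<bar>) = 1"
    by (rule prod.neutral) auto
  ultimately show ?thesis
    using lborel_affine_euclidean[of ?c 0] by (auto simp: density_1)
qed

lemma lborel_distr_swap:
  fixes b c :: "'a::euclidean_space"
  assumes "b \<in> Basis" "c \<in> Basis" 
  shows "distr lborel borel (\<lambda>x. x - (x \<bullet> (b - c)) *\<^sub>R (b - c)) = lborel" (is "distr _ _ ?T = _")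
proof (rule lborel_eqI[symmetric])
  fix l u :: 'a
  assume le: "\<And>b. b \<in> Basis \<Longrightarrow> l \<bullet> b \<le> u \<bullet> b"
  define \<pi> where "\<pi> = Transposition.transpose b c"
  have \<pi>: "\<pi> permutes Basis"
    unfolding \<pi>_def using assms by (rule permutes_swap_id)
  have coord: "?T x \<bullet> d = x \<bullet> \<pi> d" if "d \<in> Basis" for x d
    using that assms by (auto simp: \<pi>_def inner_simps inner_Basis Transposition.transpose_def)
  have inB: "\<pi> d \<in> Basis \<longleftrightarrow> d \<in> Basis" for d
    using \<pi> by (simp add: permutes_in_image)
  have inv: "\<pi> (\<pi> d) = d" for d by (simp add: \<pi>_def)
  have coord': "?T x \<bullet> \<pi> d = x \<bullet> d" if "d \<in> Basis" for x d
    using coord[of "\<pi> d" x] that by (simp add: inB inv)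
  have "?T x \<in> box l u \<longleftrightarrow> x \<in> box (?T l) (?T u)" for x
    unfolding mem_box using coord coord' inB inv by metis
  then have eq: "?T -` box l u = box (?T l) (?T u)" by auto
  have "emeasure (distr lborel borel ?T) (box l u) = emeasure lborel (box (?T l) (?T u))"
    by (subst emeasure_distr) (auto simp: eq)
  also have "\<dots> = (\<Prod>d\<in>Basis. (?T u - ?T l) \<bullet> d)"
    by (rule emeasure_lborel_box) (use le coord inB in auto)
  also have "(\<Prod>d\<in>Basis. (?T u - ?T l) \<bullet> d) = (\<Prod>d\<in>Basis. (u - l) \<bullet> \<pi> d)"
    by (rule prod.cong)
      (simp_all only: inner_diff_left[of "?T u" "?T l"] inner_diff_left[of u l] coord)
  also have "\<dots> = (\<Prod>d\<in>Basis. (u - l) \<bullet> d)"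
    by (rule prod.permute[OF \<pi>, symmetric, unfolded comp_def])
  finally show "emeasure (distr lborel borel ?T) (box l u) = (\<Prod>d\<in>Basis. (u - l) \<bullet> d)" .
qed simp

text \<open>
  The two maps of interest, the identity for the ball average and \<open>sgn\<close> for the spherical one, commute
  with linear isometries. This is all that the vanishing of first and mixed moments depends on, so
  both averages can be treated at once.
\<close>

definition isometry_equivariant :: "('a::euclidean_space \<Rightarrow> 'a) \<Rightarrow> bool" where
  "isometry_equivariant g \<longleftrightarrow>
     (\<forall>T z. linear T \<and> (\<forall>x. norm (T x) = norm x) \<longrightarrow> g (T z) = T (g z))"

lemma isometry_equivariant_id: "isometry_equivariant (\<lambda>z. z)"
  by (simp add: isometry_equivariant_def)

lemma isometry_equivariant_sgn: "isometry_equivariant sgn"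
  by (simp add: isometry_equivariant_def sgn_div_norm linear_scale)

lemma integral_unit_ball_isometry:
  fixes f :: "'a::euclidean_space \<Rightarrow> real"
  assumes "distr lborel borel T = lborel" "linear T" "\<And>x. norm (T x) = norm x"
    and f: "f \<in> borel_measurable borel"
  shows "(LINT z:ball 0 1|lborel. f (T z)) = (LINT z:ball 0 1|lborel. f z)"
proof -
  have T: "T \<in> borel_measurable borel"
    using assms(2) by (simp add: borel_measurable_continuous_onI linear_continuous_on linear_conv_bounded_linear)
  have "(LINT z:ball 0 1|lborel. f z) = (LINT z|distr lborel borel T. indicator (ball 0 1) z *\<^sub>R f z)"
    by (simp add: assms(1) set_lebesgue_integral_def)
  also have "\<dots> = (LINT z|lborel. indicator (ball 0 1) (T z) *\<^sub>R f (T z))"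
    using T f by (intro integral_distr borel_measurable_scaleR borel_measurable_indicator) auto
  also have "\<dots> = (LINT z:ball 0 1|lborel. f (T z))"
    by (simp add: set_lebesgue_integral_def indicator_def assms(3))
  finally show ?thesis by simp
qed

lemma norm_reflect:
  fixes v x :: "'a::real_inner"
  assumes "c * (v \<bullet> v) = 2"
  shows "norm (x - (c * (x \<bullet> v)) *\<^sub>R v) = norm x"
proof -
  have "(norm (x - (c * (x \<bullet> v)) *\<^sub>R v))\<^sup>2
      = (norm x)\<^sup>2 - 2 * c * (x \<bullet> v)\<^sup>2 + c * (c * (v \<bullet> v)) * (x \<bullet> v)\<^sup>2"
    unfolding power2_norm_eq_inner inner_diff_left inner_diff_right inner_scaleR_left inner_scaleR_right
      inner_commute[of v x]
    by (simp add: algebra_simps power2_eq_square)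
  then show ?thesis by (simp add: assms)
qed

lemma linear_reflect: "linear (\<lambda>x. x - (c * (x \<bullet> v)) *\<^sub>R v)"
  by (rule linearI) (simp_all add: algebra_simps inner_add_left)

lemma set_integral_sum:
  fixes f :: "'i \<Rightarrow> 'a \<Rightarrow> real"
  assumes "\<And>i. i \<in> I \<Longrightarrow> set_integrable M A (f i)"
  shows "(LINT z:A|M. (\<Sum>i\<in>I. f i z)) = (\<Sum>i\<in>I. (LINT z:A|M. f i z))"
  using assms unfolding set_lebesgue_integral_def set_integrable_def scaleR_sum_right
  by (rule Bochner_Integration.integral_sum)

lemma set_integrable_unit_ball:
  fixes f :: "'a::euclidean_space \<Rightarrow> real"
  assumes "f \<in> borel_measurable borel" "\<And>z. norm z < 1 \<Longrightarrow> \<bar>f z\<bar> \<le> B"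
  shows "set_integrable lborel (ball 0 1) f"
  unfolding set_integrable_def
  using assms emeasure_lborel_ball_finite[of 0 1]
  by (intro integrableI_bounded_set_indicator[where B=B]) auto

context
  fixes g :: "'a::euclidean_space \<Rightarrow> 'a"
  assumes equiv: "isometry_equivariant g"
    and meas [measurable]: "g \<in> borel_measurable borel"
    and bound: "\<And>z. norm z < 1 \<Longrightarrow> norm (g z) \<le> 1"
begin

lemma reflect_equivariant:
  fixes b :: 'a
  assumes "b \<in> Basis"
  shows "g (z - (2 * (z \<bullet> b)) *\<^sub>R b) = g z - (2 * (g z \<bullet> b)) *\<^sub>R b"
  using equiv linear_reflect[of 2 b] norm_reflect[of 2 b] assms
  by (force simp: isometry_equivariant_def)

lemma swap_equivariant:
  fixes b c :: 'a
  assumes "b \<in> Basis" "c \<in> Basis" "b \<noteq> c"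
  shows "g (z - (z \<bullet> (b - c)) *\<^sub>R (b - c)) = g z - (g z \<bullet> (b - c)) *\<^sub>R (b - c)"
proof -
  let ?T = "\<lambda>x. x - (x \<bullet> (b - c)) *\<^sub>R (b - c)"
  have "1 * ((b - c) \<bullet> (b - c)) = 2"
    using assms by (simp add: inner_diff_left inner_diff_right inner_Basis)
  then have "norm (?T x) = norm x" for x
    using norm_reflect[of 1 "b - c" x] by simp
  moreover have "linear ?T"
    using linear_reflect[of 1 "b - c"] by simp
  ultimately show ?thesis
    using equiv unfolding isometry_equivariant_def by (metis (no_types, lifting))
qed

lemma first_moment:
  assumes b: "b \<in> Basis"
  shows "(LINT z:ball 0 1|lborel. g z \<bullet> b) = 0"
proof -
  let ?T = "\<lambda>x. x - (2 * (x \<bullet> b)) *\<^sub>R b"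
  have "(LINT z:ball 0 1|lborel. g z \<bullet> b) = (LINT z:ball 0 1|lborel. g (?T z) \<bullet> b)"
    using lborel_distr_reflect[OF b] linear_reflect[of 2 b] norm_reflect[of 2 b] b
    by (intro integral_unit_ball_isometry[symmetric, where f = "\<lambda>z. g z \<bullet> b"]) auto
  also have "\<dots> = (LINT z:ball 0 1|lborel. - (g z \<bullet> b))"
    using b by (simp add: reflect_equivariant inner_diff_left)
  finally show ?thesis by (simp add: set_lebesgue_integral_def)
qed

lemma mixed_second_moment:
  assumes b: "b \<in> Basis" and c: "c \<in> Basis" "b \<noteq> c"
  shows "(LINT z:ball 0 1|lborel. (g z \<bullet> b) * (g z \<bullet> c)) = 0"
proof -
  let ?T = "\<lambda>x. x - (2 * (x \<bullet> b)) *\<^sub>R b"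
  have "(LINT z:ball 0 1|lborel. (g z \<bullet> b) * (g z \<bullet> c))
      = (LINT z:ball 0 1|lborel. (g (?T z) \<bullet> b) * (g (?T z) \<bullet> c))"
    using lborel_distr_reflect[OF b] linear_reflect[of 2 b] norm_reflect[of 2 b] b
    by (intro integral_unit_ball_isometry[symmetric, where f = "\<lambda>z. (g z \<bullet> b) * (g z \<bullet> c)"]) auto
  also have "\<dots> = (LINT z:ball 0 1|lborel. - ((g z \<bullet> b) * (g z \<bullet> c)))"
    using b c by (simp add: reflect_equivariant inner_diff_left inner_Basis)
  finally show ?thesis by (simp add: set_lebesgue_integral_def)
qed

lemma diagonal_second_moment:
  assumes b: "b \<in> Basis"
  shows "(LINT z:ball 0 1|lborel. (g z \<bullet> b) * (g z \<bullet> b)) =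
    (LINT z:ball 0 1|lborel. (norm (g z))\<^sup>2) / DIM('a)"
proof -
  have same: "(LINT z:ball 0 1|lborel. (g z \<bullet> c) * (g z \<bullet> c)) =
      (LINT z:ball 0 1|lborel. (g z \<bullet> b) * (g z \<bullet> b))" if c: "c \<in> Basis" for c
  proof (cases "c = b")
    case False
    let ?T = "\<lambda>x. x - (x \<bullet> (b - c)) *\<^sub>R (b - c)"
    have "(LINT z:ball 0 1|lborel. (g z \<bullet> b) * (g z \<bullet> b))
        = (LINT z:ball 0 1|lborel. (g (?T z) \<bullet> b) * (g (?T z) \<bullet> b))"
      using lborel_distr_swap[OF b c] linear_reflect[of 1 "b - c"] norm_reflect[of 1 "b - c"] b c False
      by (intro integral_unit_ball_isometry[symmetric, where f = "\<lambda>z. (g z \<bullet> b) * (g z \<bullet> b)"])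
        (auto simp: inner_simps inner_Basis)
    also have "\<dots> = (LINT z:ball 0 1|lborel. (g z \<bullet> c) * (g z \<bullet> c))"
      using b c False by (subst (1 2) swap_equivariant) (simp_all add: inner_simps inner_Basis)
    finally show ?thesis by simp
  qed simp
  have int: "set_integrable lborel (ball 0 1) (\<lambda>z. (g z \<bullet> c) * (g z \<bullet> c))" if "c \<in> Basis" for c
  proof (rule set_integrable_unit_ball[where B=1])
    fix z :: 'a assume "norm z < 1"
    then have "\<bar>g z \<bullet> c\<bar> \<le> 1" using bound[of z] Basis_le_norm[OF that, of "g z"] by simp
    then show "\<bar>(g z \<bullet> c) * (g z \<bullet> c)\<bar> \<le> 1"
      unfolding abs_mult by (intro mult_le_one) auto
  qed simp
  have "(LINT z:ball 0 1|lborel. (norm (g z))\<^sup>2) =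
      (LINT z:ball 0 1|lborel. (\<Sum>c\<in>Basis. (g z \<bullet> c) * (g z \<bullet> c)))"
    by (simp add: power2_norm_eq_inner euclidean_inner[symmetric])
  also have "\<dots> = (\<Sum>c\<in>Basis. (LINT z:ball 0 1|lborel. (g z \<bullet> c) * (g z \<bullet> c)))"
    using int by (rule set_integral_sum)
  also have "\<dots> = DIM('a) * (LINT z:ball 0 1|lborel. (g z \<bullet> b) * (g z \<bullet> b))"
    using same by simp
  finally show ?thesis by simp
qed

lemma integral_unit_ball_linear:
  fixes L :: "'a \<Rightarrow> real"
  assumes "linear L"
  shows "(LINT z:ball 0 1|lborel. L (g z)) = 0"
proof -
  have "L (g z) = (\<Sum>b\<in>Basis. (g z \<bullet> b) * L b)" for z
    using linear_sum[OF assms, of "\<lambda>b. (g z \<bullet> b) *\<^sub>R b" Basis]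
    by (simp add: euclidean_representation linear_scale[OF assms])
  moreover have "set_integrable lborel (ball 0 1) (\<lambda>z. g z \<bullet> b)" if "b \<in> Basis" for b
    using bound Basis_le_norm[OF that] by (intro set_integrable_unit_ball[where B=1])
      (auto intro: order_trans)
  ultimately have "(LINT z:ball 0 1|lborel. L (g z)) =
      (\<Sum>b\<in>Basis. (LINT z:ball 0 1|lborel. (g z \<bullet> b) * L b))"
    by (simp only:) (rule set_integral_sum, simp)
  then show ?thesis by (simp add: first_moment)
qed

text \<open>
  The integral picks out the trace of the quadratic form because, by symmetry, the second moments form
  a multiple of the identity matrix.
\<close>

lemma integral_unit_ball_bilinear:
  fixes B :: "'a \<Rightarrow> 'a \<Rightarrow> real"
  assumes "bilinear B"
  shows "(LINT z:ball 0 1|lborel. B (g z) (g z)) =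
    (LINT z:ball 0 1|lborel. (norm (g z))\<^sup>2) / DIM('a) * (\<Sum>b\<in>Basis. B b b)"
proof -
  have "B (g z) (g z) = (\<Sum>(b, c)\<in>Basis \<times> Basis. (g z \<bullet> b) * (g z \<bullet> c) * B b c)" for z
    using bilinear_sum[OF assms, of "\<lambda>b. (g z \<bullet> b) *\<^sub>R b" Basis "\<lambda>b. (g z \<bullet> b) *\<^sub>R b" Basis]
    by (simp add: euclidean_representation bilinear_lmul[OF assms] bilinear_rmul[OF assms] mult.assoc
        case_prod_unfold mult.left_commute)
  moreover have "set_integrable lborel (ball 0 1) (\<lambda>z. (g z \<bullet> b) * (g z \<bullet> c))"
    if "b \<in> Basis" "c \<in> Basis" for b c
  proof (rule set_integrable_unit_ball[where B=1])
    fix z :: 'a assume "norm z < 1"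
    then have "\<bar>g z \<bullet> b\<bar> \<le> 1" "\<bar>g z \<bullet> c\<bar> \<le> 1"
      using bound[of z] Basis_le_norm[of _ "g z"] that by fastforce+
    then show "\<bar>(g z \<bullet> b) * (g z \<bullet> c)\<bar> \<le> 1"
      unfolding abs_mult by (intro mult_le_one) auto
  qed simp
  ultimately have "(LINT z:ball 0 1|lborel. B (g z) (g z)) =
      (\<Sum>p\<in>Basis \<times> Basis. (LINT z:ball 0 1|lborel.
        case p of (b, c) \<Rightarrow> (g z \<bullet> b) * (g z \<bullet> c) * B b c))"
    by (simp only:) (rule set_integral_sum, auto)
  also have "\<dots> = (\<Sum>(b, c)\<in>Basis \<times> Basis. (LINT z:ball 0 1|lborel. (g z \<bullet> b) * (g z \<bullet> c)) * B b c)"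
    by (rule sum.cong) auto
  also have "\<dots> = (\<Sum>b\<in>Basis. \<Sum>c\<in>Basis. if c = b then
      (LINT z:ball 0 1|lborel. (norm (g z))\<^sup>2) / DIM('a) * B b b else 0)"
    unfolding sum.cartesian_product[symmetric]
    by (intro sum.cong) (auto simp: mixed_second_moment diagonal_second_moment)
  also have "\<dots> = (LINT z:ball 0 1|lborel. (norm (g z))\<^sup>2) / DIM('a) * (\<Sum>b\<in>Basis. B b b)"
    by (simp add: sum_distrib_left)
  finally show ?thesis .
qed

end

lemma integral_unit_ball_const:
  "(LINT z:ball (0::'a::euclidean_space) 1|lborel. c) = unit_ball_vol (real DIM('a)) * (c::real)"
  by (simp add: set_lebesgue_integral_def content_ball)

lemma integral_unit_ball_norm_sgn_square:
  "(LINT z:ball (0::'a::euclidean_space) 1|lborel. (norm (sgn z))\<^sup>2) = unit_ball_vol (real DIM('a))"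
proof -
  have "(LINT z:ball (0::'a) 1|lborel. (norm (sgn z))\<^sup>2) = (LINT z:ball (0::'a) 1|lborel. 1)"
    unfolding set_lebesgue_integral_def
  proof (rule Bochner_Integration.integral_cong_AE)
    show "AE z in lborel. indicator (ball 0 1) z *\<^sub>R (norm (sgn (z::'a)))\<^sup>2 = indicator (ball 0 1) z *\<^sub>R 1"
      using AE_lborel_singleton[of "0::'a"] by eventually_elim (simp add: norm_sgn)
  qed (auto intro!: borel_measurable_times borel_measurable_power borel_measurable_norm borel_measurable_indicator)
  then show ?thesis by (simp add: integral_unit_ball_const)
qed


text \<open>
  The integral of \<open>1 - |x|\<^sup>2\<close> over the unit ball is the volume of the region \<open>|x|\<^sup>2 < s < 1\<close> in
  \<open>\<real>\<^sup>n \<times> \<real>\<close>. Slicing the region at height \<open>s\<close> gives balls of radius \<open>\<surd>s\<close>, so the volume is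
  \<open>|B|\<close> times the integral of \<open>s\<^sup>n\<^sup>/\<^sup>2\<close> over the unit interval.
\<close>

lemma integral_unit_ball_norm_square:
  "(LINT z:ball (0::'a::euclidean_space) 1|lborel. (norm z)\<^sup>2) =
    unit_ball_vol (real DIM('a)) * (real DIM('a) / (real DIM('a) + 2))"
proof -
  let ?n = "real DIM('a)" and ?\<omega> = "unit_ball_vol (real DIM('a))"
  let ?S = "{(x::'a, s::real). norm x ^ 2 < s \<and> s < 1}"
  have S: "?S \<in> sets (lborel \<Otimes>\<^sub>M lborel)"
  proof -
    have "open ?S"
      unfolding case_prod_unfold by (intro open_Collect_conj open_Collect_less continuous_intros)
    then show ?thesis unfolding lborel_prod by simp
  qed
  have s1: "emeasure lborel (Pair x -` ?S) = ennreal (indicator (ball 0 1) x * (1 - (norm x)\<^sup>2))" for x :: 'a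
  proof -
    have "Pair x -` ?S = {(norm x)\<^sup>2<..<1}" by auto
    then have *: "emeasure lborel (Pair x -` ?S) = emeasure lborel {(norm x)\<^sup>2<..<1}" by (rule arg_cong)
    show ?thesis
    proof (cases "norm x < 1")
      case True
      then have "(norm x)\<^sup>2 \<le> 1" by (simp add: power_le_one)
      then show ?thesis unfolding * using True by (simp add: indicator_def)
    next
      case False
      then have "(norm x)\<^sup>2 \<ge> 1" by (simp add: one_le_power)
      then have "{(norm x)\<^sup>2<..<1} = {}" by auto
      then show ?thesis unfolding * using False by (simp add: indicator_def)
    qed
  qed
  have s2: "emeasure lborel ((\<lambda>x. (x, s)) -` ?S) = ennreal (?\<omega> * s powr (?n / 2)) * indicator {0..1} s"
    if "s \<noteq> 0" "s \<noteq> 1" for s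
  proof (cases "0 < s \<and> s < 1")
    case True
    have "norm x ^ 2 < s \<longleftrightarrow> norm x < sqrt s" for x :: 'a
      using real_sqrt_less_iff[of "(norm x)\<^sup>2" s] by simp
    then have "x \<in> (\<lambda>x. (x, s)) -` ?S \<longleftrightarrow> x \<in> ball 0 (sqrt s)" for x :: 'a
      using True by (simp only: vimage_eq mem_Collect_eq case_prod_conv mem_ball_0 simp_thms)
    then have "(\<lambda>x::'a. (x, s)) -` ?S = ball 0 (sqrt s)"
      by (rule set_eqI)
    moreover have "emeasure lborel (ball (0::'a) (sqrt s)) = ennreal (?\<omega> * sqrt s ^ DIM('a))"
      using True by (simp add: emeasure_ball)
    moreover have "sqrt s ^ DIM('a) = (s powr (1 / 2)) ^ DIM('a)"
      using True by (simp only: powr_half_sqrt less_imp_le)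
    moreover have "\<dots> = s powr (?n / 2)"
      using True by (simp add: powr_power)
    moreover have "s \<in> {0..1}" using True by simp
    ultimately show ?thesis by simp
  next
    case False
    have "(norm x)\<^sup>2 < s \<Longrightarrow> 0 < s" for x :: 'a
      by (rule le_less_trans[OF zero_le_power2])
    then have "(\<lambda>x::'a. (x, s)) -` ?S = {}" using False by auto
    moreover have "s \<notin> {0..1}" using False that by auto
    ultimately show ?thesis by (simp only: emeasure_empty) simp
  qed
  have fin: "(\<integral>\<^sup>+x. ennreal (indicator (ball 0 1) x * (1 - (norm (x::'a))\<^sup>2)) \<partial>lborel) =
      (\<integral>\<^sup>+s. ennreal (?\<omega> * s powr (?n / 2)) * indicator {0..1} s \<partial>lborel)"
  proof -
    have "(\<integral>\<^sup>+x. ennreal (indicator (ball 0 1) x * (1 - (norm (x::'a))\<^sup>2)) \<partial>lborel) =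
        emeasure (lborel \<Otimes>\<^sub>M lborel) ?S"
      by (subst lborel.emeasure_pair_measure_alt[OF S]) (simp only: s1)
    also have "\<dots> = (\<integral>\<^sup>+s. emeasure lborel ((\<lambda>x::'a. (x, s)) -` ?S) \<partial>lborel)"
      by (rule lborel_pair.emeasure_pair_measure_alt2[OF S])
    also have "\<dots> = (\<integral>\<^sup>+s. ennreal (?\<omega> * s powr (?n / 2)) * indicator {0..1} s \<partial>lborel)"
    proof (rule nn_integral_cong_AE)
      show "AE s in lborel. emeasure lborel ((\<lambda>x::'a. (x, s)) -` ?S) =
          ennreal (?\<omega> * s powr (?n / 2)) * indicator {0..1} s"
        using AE_lborel_singleton[of 0] AE_lborel_singleton[of 1]
        by eventually_elim (rule s2)
    qed
    finally show ?thesis .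
  qed
  also have "(\<integral>\<^sup>+s. ennreal (?\<omega> * s powr (?n / 2)) * indicator {0..1} s \<partial>lborel) =
      ennreal (?\<omega> * (1 / (?n / 2 + 1)))"
  proof (rule nn_integral_has_integral_lebesgue')
    have "((\<lambda>s. s powr (?n / 2)) has_integral 1 / (?n / 2 + 1)) {0..1}"
      using has_integral_powr_from_0[of "?n / 2" 1] by simp
    then show "((\<lambda>s. ?\<omega> * s powr (?n / 2)) has_integral ?\<omega> * (1 / (?n / 2 + 1))) {0..1}"
      by (rule has_integral_mult_right)
  qed simp
  finally have nn: "(\<integral>\<^sup>+x. ennreal (indicator (ball 0 1) x * (1 - (norm (x::'a))\<^sup>2)) \<partial>lborel) =
      ennreal (?\<omega> * (1 / (?n / 2 + 1)))" .
  have int: "set_integrable lborel (ball 0 1) (\<lambda>x::'a. (norm x)\<^sup>2)"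
    by (rule set_integrable_unit_ball[where B=1]) (auto simp: abs_square_le_1)
  have int1: "set_integrable lborel (ball 0 1) (\<lambda>x::'a. 1::real)"
    by (rule set_integrable_unit_ball[where B=1]) auto
  have "(LINT x:ball 0 1|lborel. 1 - (norm (x::'a))\<^sup>2) =
      enn2real (\<integral>\<^sup>+x. ennreal (indicator (ball 0 1) x * (1 - (norm (x::'a))\<^sup>2)) \<partial>lborel)"
    unfolding set_lebesgue_integral_def real_scaleR_def
  proof (rule integral_eq_nn_integral)
    show "AE x in lborel. 0 \<le> indicator (ball 0 1) x * (1 - (norm (x::'a))\<^sup>2)"
      by (auto simp: indicator_def abs_square_le_1)
  qed (auto intro!: borel_measurable_times borel_measurable_indicator)
  also have "\<dots> = ?\<omega> * (1 / (?n / 2 + 1))"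
    unfolding nn by (rule enn2real_ennreal) simp
  finally have "(LINT x:ball 0 1|lborel. 1 - (norm (x::'a))\<^sup>2) = ?\<omega> * (1 / (?n / 2 + 1))" .
  moreover have "(LINT x:ball 0 1|lborel. 1 - (norm (x::'a))\<^sup>2) =
      ?\<omega> - (LINT x:ball (0::'a) 1|lborel. (norm x)\<^sup>2)"
    using int int1 by (simp add: integral_unit_ball_const)
  ultimately have "(LINT x:ball (0::'a) 1|lborel. (norm x)\<^sup>2) = ?\<omega> * (1 - 1 / (?n / 2 + 1))"
    unfolding right_diff_distrib by linarith
  moreover have "1 - 1 / (?n / 2 + 1) = ?n / (?n + 2)"
    using DIM_positive[where 'a='a] by (simp add: divide_simps)
  ultimately show ?thesis by (simp only:)
qed

section \<open>Taylor expansion of the averages\<close>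

text \<open>
  Here \<open>D x v\<close> and \<open>Q x v\<close> are the first and second derivatives of \<open>U\<close> at \<open>x\<close> in direction \<open>v\<close>. The
  remainder is uniform in \<open>v\<close> because \<open>Q\<close> is uniformly continuous on compact sets; uniformity is what
  allows the expansion to be integrated over the unit ball.
\<close>

lemma second_order_expansion_uniform:
  fixes U :: "'a::euclidean_space \<Rightarrow> real"
  assumes D1: "\<And>x v t. ((\<lambda>t. U (x + t *\<^sub>R v)) has_real_derivative D (x + t *\<^sub>R v) v) (at t)"
    and D2: "\<And>x v t. ((\<lambda>t. D (x + t *\<^sub>R v) v) has_real_derivative Q (x + t *\<^sub>R v) v) (at t)"
    and Q: "continuous_on UNIV (\<lambda>(x, v). Q x v)"
    and "\<eta> > 0"
  obtains \<rho> where "\<rho> > 0" "\<And>v r. norm v \<le> 1 \<Longrightarrow> 0 < r \<Longrightarrow> r < \<rho> \<Longrightarrow>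
    \<bar>U (x0 + r *\<^sub>R v) - (U x0 + r * D x0 v + r\<^sup>2 / 2 * Q x0 v)\<bar> \<le> \<eta> * r\<^sup>2"
proof -
  let ?K = "cball x0 1 \<times> cball (0::'a) 1"
  have "uniformly_continuous_on ?K (\<lambda>(x, v). Q x v)"
    by (intro compact_uniformly_continuous compact_Times compact_cball continuous_on_subset[OF Q]) auto
  then obtain d where d: "d > 0"
    "\<And>p q. p \<in> ?K \<Longrightarrow> q \<in> ?K \<Longrightarrow> dist q p < d \<Longrightarrow>
      dist ((\<lambda>(x, v). Q x v) q) ((\<lambda>(x, v). Q x v) p) < \<eta>"
    using \<open>\<eta> > 0\<close> unfolding uniformly_continuous_on_def by metis
  show thesis
  proof (rule that[of "min 1 d"])
    fix v :: 'a and r :: real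
    assume v: "norm v \<le> 1" and r: "0 < r" "r < min 1 d"
    define diff where "diff m t = (if m = 0 then U (x0 + t *\<^sub>R v)
      else if m = 1 then D (x0 + t *\<^sub>R v) v else Q (x0 + t *\<^sub>R v) v)" for m :: nat and t
    have "(diff m has_real_derivative diff (Suc m) t) (at t)" if "m < 2" for m t
      using that D1[of x0 v t] D2[of x0 v t] by (cases m) (simp_all add: diff_def[abs_def])
    then obtain t where t: "0 < t" "t < r"
      "U (x0 + r *\<^sub>R v) = (\<Sum>m<2. diff m 0 / fact m * (r - 0) ^ m) + diff 2 t / fact 2 * (r - 0) ^ 2"
      using Taylor_up[of 2 diff "\<lambda>t. U (x0 + t *\<^sub>R v)" 0 r 0] r by (auto simp: diff_def[abs_def])
    then have eq: "U (x0 + r *\<^sub>R v) = U x0 + r * D x0 v + r\<^sup>2 / 2 * Q (x0 + t *\<^sub>R v) v"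
      by (simp add: diff_def numeral_2_eq_2 mult.commute)
    have "t * norm v \<le> t"
      using v t by (simp add: mult_left_le)
    then have tv: "t * norm v \<le> 1" "t * norm v < d"
      using t r by linarith+
    have "dist ((\<lambda>(x, v). Q x v) (x0 + t *\<^sub>R v, v)) ((\<lambda>(x, v). Q x v) (x0, v)) < \<eta>"
      using v t r tv by (intro d(2)) (auto simp: dist_Pair_Pair dist_norm)
    then have "\<bar>Q (x0 + t *\<^sub>R v) v - Q x0 v\<bar> \<le> \<eta>"
      by (simp add: dist_real_def)
    then have "r\<^sup>2 / 2 * \<bar>Q (x0 + t *\<^sub>R v) v - Q x0 v\<bar> \<le> r\<^sup>2 / 2 * \<eta>"
      by (intro mult_left_mono) auto
    moreover have "U (x0 + r *\<^sub>R v) - (U x0 + r * D x0 v + r\<^sup>2 / 2 * Q x0 v) =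
        r\<^sup>2 / 2 * (Q (x0 + t *\<^sub>R v) v - Q x0 v)"
      by (simp add: eq algebra_simps)
    ultimately have "\<bar>U (x0 + r *\<^sub>R v) - (U x0 + r * D x0 v + r\<^sup>2 / 2 * Q x0 v)\<bar> \<le> r\<^sup>2 / 2 * \<eta>"
      by (simp only: abs_mult) simp
    also have "\<dots> \<le> \<eta> * r\<^sup>2" using \<open>\<eta> > 0\<close> by simp
    finally show "\<bar>U (x0 + r *\<^sub>R v) - (U x0 + r * D x0 v + r\<^sup>2 / 2 * Q x0 v)\<bar> \<le> \<eta> * r\<^sup>2" .
  qed (use d in auto)
qed

lemma set_integrable_unit_ball_comp:
  fixes F :: "'a::euclidean_space \<Rightarrow> real"
  assumes F: "continuous_on UNIV F" and g: "g \<in> borel_measurable borel"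
    and bound: "\<And>z::'a. norm z < 1 \<Longrightarrow> norm (g z) \<le> 1"
  shows "set_integrable lborel (ball 0 1) (\<lambda>z. F (g z))"
proof -
  have "bounded (F ` cball 0 1)"
    by (intro compact_imp_bounded compact_continuous_image continuous_on_subset[OF F]) auto
  then obtain B where "\<forall>x\<in>cball 0 1. \<bar>F x\<bar> \<le> B"
    by (auto simp: bounded_iff)
  then have B: "\<bar>F x\<bar> \<le> B" if "norm x \<le> 1" for x
    using that by simp
  show ?thesis
    using bound by (intro set_integrable_unit_ball[where B=B] B borel_measurable_continuous_on[OF F] g) auto
qed

text \<open>
  Integrating the expansion over the ball: the linear term disappears and the quadratic term
  becomes a multiple of the trace of \<open>B\<close>.
\<close>

lemma unit_ball_average_expansion:
  fixes U :: "'a::euclidean_space \<Rightarrow> real"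
  assumes g: "isometry_equivariant g" "g \<in> borel_measurable borel"
      "\<And>z::'a. norm z < 1 \<Longrightarrow> norm (g z) \<le> 1"
    and U: "continuous_on UNIV U" and L: "linear L" and B: "bilinear B"
    and "r > 0"
    and taylor: "\<And>v. norm v \<le> 1 \<Longrightarrow> \<bar>U (x0 + r *\<^sub>R v) - (U x0 + r * L v + r\<^sup>2 / 2 * B v v)\<bar> \<le> e"
  shows "\<bar>(LINT z:ball 0 1|lborel. U (x0 + r *\<^sub>R g z)) - (unit_ball_vol (real DIM('a)) * U x0 +
    r\<^sup>2 / 2 * ((LINT z:ball 0 1|lborel. (norm (g z))\<^sup>2) / DIM('a) * (\<Sum>b\<in>Basis. B b b)))\<bar>
    \<le> unit_ball_vol (real DIM('a)) * e"
proof -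
  have contL: "continuous_on UNIV L"
    using L by (simp add: linear_continuous_on linear_conv_bounded_linear)
  have contB: "continuous_on UNIV (\<lambda>v. B v v)"
    by (rule bilinear_continuous_on_compose[OF continuous_on_id continuous_on_id B])
  note integrable = set_integrable_unit_ball_comp[OF _ g(2,3)]
  have iU: "set_integrable lborel (ball 0 1) (\<lambda>z. U (x0 + r *\<^sub>R g z))"
    by (rule integrable[of "\<lambda>v. U (x0 + r *\<^sub>R v)"])
      (intro continuous_on_compose2[OF U] continuous_intros, auto)
  have i0: "set_integrable lborel (ball 0 1) (\<lambda>z::'a. U x0)"
    by (rule integrable[of "\<lambda>v. U x0"]) auto
  have iL: "set_integrable lborel (ball 0 1) (\<lambda>z. r * L (g z))"
    by (rule integrable[of "\<lambda>v. r * L v"]) (intro contL continuous_intros)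
  have iB: "set_integrable lborel (ball 0 1) (\<lambda>z. r\<^sup>2 / 2 * B (g z) (g z))"
    by (rule integrable[of "\<lambda>v. r\<^sup>2 / 2 * B v v"]) (intro contB continuous_intros)
  define E where "E z = U (x0 + r *\<^sub>R g z) - (U x0 + r * L (g z) + r\<^sup>2 / 2 * B (g z) (g z))" for z
  have iE: "set_integrable lborel (ball 0 1) E"
    unfolding E_def by (intro set_integral_diff set_integral_add iU i0 iL iB)
  have "(LINT z:ball 0 1|lborel. E z) = (LINT z:ball 0 1|lborel. U (x0 + r *\<^sub>R g z)) -
      ((LINT z:ball (0::'a) 1|lborel. U x0) + (LINT z:ball 0 1|lborel. r * L (g z)) +
       (LINT z:ball 0 1|lborel. r\<^sup>2 / 2 * B (g z) (g z)))"
    unfolding E_def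
    by (simp only: set_integral_diff set_integral_add iU i0 iL iB)
  also have "\<dots> = (LINT z:ball 0 1|lborel. U (x0 + r *\<^sub>R g z)) - (unit_ball_vol (real DIM('a)) * U x0 +
    r\<^sup>2 / 2 * ((LINT z:ball 0 1|lborel. (norm (g z))\<^sup>2) / DIM('a) * (\<Sum>b\<in>Basis. B b b)))"
    by (simp only: integral_unit_ball_linear[OF g L] integral_unit_ball_bilinear[OF g B]
        integral_unit_ball_const set_integral_mult_right mult_zero_right add_0_right)
  finally have eq: "(LINT z:ball 0 1|lborel. E z) = \<dots>" .
  have "\<bar>LINT z:ball 0 1|lborel. E z\<bar> \<le> (LINT z:ball 0 1|lborel. \<bar>E z\<bar>)"
    using iE unfolding set_lebesgue_integral_def set_integrable_def
    using integral_abs_bound[of lborel "\<lambda>z. indicator (ball 0 1) z *\<^sub>R E z"] by (simp add: abs_mult)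
  also have "\<dots> \<le> (LINT z:ball (0::'a) 1|lborel. e)"
  proof (rule set_integral_mono)
    show "set_integrable lborel (ball 0 1) (\<lambda>z. \<bar>E z\<bar>)" using iE by (rule set_integrable_abs)
    show "set_integrable lborel (ball 0 1) (\<lambda>z::'a. e)" by (rule integrable[of "\<lambda>v. e"]) auto
    show "\<bar>E z\<bar> \<le> e" if "z \<in> ball 0 1" for z
      using that taylor[of "g z"] g(3)[of z] by (simp add: E_def)
  qed
  finally show ?thesis by (simp add: eq integral_unit_ball_const)
qed

text \<open>
  The expansions of the two averages agree below order \<open>r\<^sup>2\<close>; the coefficients of \<open>r\<^sup>2\<close> differ by
  \<open>(n / (n + 2) - \<kappa>\<^sup>2) / (2 n)\<close> times the Laplacian. If the Laplacian were negative, this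
  difference would beat the error for a small \<open>r\<close>.
\<close>

lemma trace_nonneg_of_average_inequality:
  fixes U :: "'a::euclidean_space \<Rightarrow> real"
  assumes D1: "\<And>x v t. ((\<lambda>t. U (x + t *\<^sub>R v)) has_real_derivative D (x + t *\<^sub>R v) v) (at t)"
    and D2: "\<And>x v t. ((\<lambda>t. D (x + t *\<^sub>R v) v) has_real_derivative Q (x + t *\<^sub>R v) v) (at t)"
    and Q: "continuous_on UNIV (\<lambda>(x, v). Q x v)"
    and U: "continuous_on UNIV U"
    and L: "linear (D x0)" and B: "bilinear B" and QB: "\<And>v. Q x0 v = B v v"
    and \<kappa>: "0 < \<kappa>" "\<kappa> < 1" "\<kappa>\<^sup>2 < real DIM('a) / (real DIM('a) + 2)"
    and "\<rho>0 > 0"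
    and ineq: "\<And>r. 0 < r \<Longrightarrow> r < \<rho>0 \<Longrightarrow> (LINT z:ball 0 1|lborel. U (x0 + (\<kappa> * r) *\<^sub>R sgn z))
      \<le> (LINT z:ball 0 1|lborel. U (x0 + r *\<^sub>R z))"
  shows "0 \<le> (\<Sum>b\<in>Basis. Q x0 b)"
proof (rule ccontr)
  define S where "S = (\<Sum>b\<in>Basis. B b b)"
  define n where "n = real DIM('a)"
  define w where "w = unit_ball_vol n"
  define c where "c = n / (n + 2) - \<kappa>\<^sup>2"
  have pos: "n > 0" "w > 0" "c > 0" using \<kappa>(3) by (auto simp: n_def w_def c_def)
  assume "\<not> 0 \<le> (\<Sum>b\<in>Basis. Q x0 b)"
  then have S: "S < 0" by (simp add: S_def QB)
  \<comment> \<open>The two errors add up to \<open>2 e r\<^sup>2\<close>, half of the main term \<open>c (- S) / (2 n) r\<^sup>2 = 4 e r\<^sup>2\<close>, per unit of volume.\<close>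
  define e where "e = c * (- S) / (8 * n)"
  have "e > 0" unfolding e_def using pos S by (intro divide_pos_pos mult_pos_pos) auto
  then obtain \<rho> where \<rho>: "\<rho> > 0" "\<And>v r. norm v \<le> 1 \<Longrightarrow> 0 < r \<Longrightarrow> r < \<rho> \<Longrightarrow>
      \<bar>U (x0 + r *\<^sub>R v) - (U x0 + r * D x0 v + r\<^sup>2 / 2 * Q x0 v)\<bar> \<le> e * r\<^sup>2"
    using second_order_expansion_uniform[OF D1 D2 Q] by blast
  define r where "r = min \<rho> \<rho>0 / 2"
  have r: "0 < r" "r < \<rho>" "r < \<rho>0" using \<rho>(1) \<open>\<rho>0 > 0\<close> by (auto simp: r_def)
  have taylor: "\<bar>U (x0 + r *\<^sub>R v) - (U x0 + r * D x0 v + r\<^sup>2 / 2 * B v v)\<bar> \<le> e * r\<^sup>2"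
    if "norm v \<le> 1" for v
    using \<rho>(2)[OF that r(1,2)] by (simp add: QB)
  have equiv: "isometry_equivariant (\<lambda>z::'a. \<kappa> *\<^sub>R sgn z)"
    using isometry_equivariant_sgn[where 'a='a] by (auto simp: isometry_equivariant_def linear_scale)
  have 1: "\<bar>(LINT z:ball 0 1|lborel. U (x0 + r *\<^sub>R z)) - (w * U x0 + r\<^sup>2 / 2 * (w * (n / (n + 2)) / n * S))\<bar>
      \<le> w * (e * r\<^sup>2)"
    using unit_ball_average_expansion[OF isometry_equivariant_id _ _ U L B r(1) taylor]
    unfolding integral_unit_ball_norm_square n_def[symmetric] w_def[symmetric] S_def[symmetric]
    by simp
  have 2: "\<bar>(LINT z:ball 0 1|lborel. U (x0 + (\<kappa> * r) *\<^sub>R sgn z)) - (w * U x0 + r\<^sup>2 / 2 * (w * \<kappa>\<^sup>2 / n * S))\<bar>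
      \<le> w * (e * r\<^sup>2)"
  proof -
    have bound: "norm (\<kappa> *\<^sub>R sgn z) \<le> 1" for z :: 'a
      using \<kappa> by (simp add: norm_sgn)
    have m: "(LINT z:ball (0::'a) 1|lborel. (norm (\<kappa> *\<^sub>R sgn z))\<^sup>2) = w * \<kappa>\<^sup>2"
      unfolding norm_scaleR power_mult_distrib set_integral_mult_right integral_unit_ball_norm_sgn_square
      by (simp add: w_def n_def)
    have sc: "r *\<^sub>R \<kappa> *\<^sub>R sgn z = (\<kappa> * r) *\<^sub>R sgn z" for z :: 'a
      by (simp add: mult.commute)
    show ?thesis
      using unit_ball_average_expansion[OF equiv _ bound U L B r(1) taylor]
      unfolding m sc n_def[symmetric] w_def[symmetric] S_def[symmetric] by simp
  qed
  have "r\<^sup>2 / 2 * (w * p / n * S) - r\<^sup>2 / 2 * (w * q / n * S) = r\<^sup>2 * w * ((p - q) * S / (2 * n))" for p q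
    using pos by (simp add: field_simps)
  then have "r\<^sup>2 / 2 * (w * (n / (n + 2)) / n * S) - r\<^sup>2 / 2 * (w * \<kappa>\<^sup>2 / n * S) = r\<^sup>2 * w * (c * S / (2 * n))"
    unfolding c_def .
  also have "c * S / (2 * n) = - 4 * e"
    using pos by (simp add: e_def)
  finally have "- (2 * (w * (e * r\<^sup>2))) \<le> r\<^sup>2 * w * (- 4 * e)"
    using 1 2 ineq[OF r(1,3)] by linarith
  moreover have "w * (e * r\<^sup>2) > 0" using pos r \<open>e > 0\<close> by simp
  ultimately show False by (simp add: algebra_simps)
qed

section \<open>Mollification with a polynomial bump\<close>

text \<open>
  Up to normalisation, \<open>bump e 3\<close> serves as the mollifier. A power of the truncated polynomial
  \<open>e\<^sup>2 - |x|\<^sup>2\<close> has explicit derivatives in terms of lower powers, and the cube is the lowest one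
  that is twice continuously differentiable.
\<close>

definition bump :: "real \<Rightarrow> nat \<Rightarrow> 'a::euclidean_space \<Rightarrow> real" where
  "bump e k x = max 0 (e\<^sup>2 - x \<bullet> x) ^ k"

lemma has_real_derivative_max_power:
  fixes s :: real
  assumes "k \<ge> 1"
  shows "((\<lambda>s. max 0 s ^ Suc k) has_real_derivative real (Suc k) * max 0 s ^ k) (at s)"
proof -
  consider "s > 0" | "s < 0" | "s = 0" by linarith
  then show ?thesis
  proof cases
    case 1
    have "((\<lambda>s. s ^ Suc k) has_real_derivative real (Suc k) * s ^ k) (at s)"
      using DERIV_pow[of "Suc k" s UNIV] by simp
    then have "((\<lambda>s. max 0 s ^ Suc k) has_real_derivative real (Suc k) * s ^ k) (at s)"
      by (rule has_field_derivative_transform_within_open[where S = "{0<..}"]) (use 1 in auto)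
    then show ?thesis using 1 by simp
  next
    case 2
    have "((\<lambda>s. max 0 s ^ Suc k) has_real_derivative 0) (at s)"
      by (rule has_field_derivative_transform_within_open[where S = "{..<0}" and f = "\<lambda>_. 0"])
        (use 2 in auto)
    moreover have "real (Suc k) * max 0 s ^ k = 0" using 2 assms by simp
    ultimately show ?thesis by (simp only:)
  next
    case 3
    \<comment> \<open>The difference quotient at \<open>0\<close> is the continuous function \<open>max 0 z ^ k\<close>.\<close>
    have "max 0 z ^ Suc k - max 0 (0::real) ^ Suc k = max 0 z ^ k * (z - 0)" for z :: real
      using assms by (simp add: max_def)
    moreover have "isCont (\<lambda>z::real. max 0 z ^ k) 0"
      by (intro continuous_intros)
    ultimately have "((\<lambda>s. max 0 s ^ Suc k) has_real_derivative max 0 0 ^ k) (at 0)"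
      unfolding CARAT_DERIV by (intro exI[of _ "\<lambda>z. max 0 z ^ k"]) simp
    then show ?thesis using 3 assms by (cases k) simp_all
  qed
qed

lemma bump_nonneg: "bump e k x \<ge> 0"
  by (simp add: bump_def)

lemma bump_eq_0:
  assumes "e > 0" "k \<ge> 1" "norm x \<ge> e"
  shows "bump e k x = 0"
proof -
  have "e\<^sup>2 \<le> x \<bullet> x"
    using assms power_mono[of e "norm x" 2] by (simp add: power2_norm_eq_inner)
  then show ?thesis using assms(2) by (simp add: bump_def max_def)
qed

lemma continuous_bump [continuous_intros]:
  fixes f :: "'b::topological_space \<Rightarrow> 'a::euclidean_space"
  assumes "continuous_on S f"
  shows "continuous_on S (\<lambda>x. bump e k (f x))"
  unfolding bump_def by (intro continuous_intros assms)

lemma bump_line_derivative: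
  assumes "k \<ge> 1"
  shows "((\<lambda>t. bump e (Suc k) (x + t *\<^sub>R v)) has_real_derivative
    - 2 * real (Suc k) * ((x + t *\<^sub>R v) \<bullet> v) * bump e k (x + t *\<^sub>R v)) (at t)"
proof -
  have "((\<lambda>t. e\<^sup>2 - (x + t *\<^sub>R v) \<bullet> (x + t *\<^sub>R v)) has_real_derivative - 2 * ((x + t *\<^sub>R v) \<bullet> v)) (at t)"
    unfolding inner_add_left inner_add_right inner_scaleR_left inner_scaleR_right
    by (auto intro!: derivative_eq_intros simp: inner_commute algebra_simps)
  from DERIV_chain'[OF this has_real_derivative_max_power[OF assms]]
  show ?thesis unfolding bump_def by (rule DERIV_cong) (simp add: algebra_simps)
qed

lemma convolution_line_derivative:
  fixes u f f' :: "'a::euclidean_space \<Rightarrow> real"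
  assumes u: "continuous_on UNIV u" and f: "continuous_on UNIV f" and f': "continuous_on UNIV f'"
    and deriv: "\<And>z t. ((\<lambda>t. f (z + t *\<^sub>R v)) has_real_derivative f' (z + t *\<^sub>R v)) (at t)"
  shows "((\<lambda>t. integral (cbox a b) (\<lambda>y. u y * f (x + t *\<^sub>R v - y))) has_real_derivative
    integral (cbox a b) (\<lambda>y. u y * f' (x + t *\<^sub>R v - y))) (at t)"
proof (rule leibniz_rule_field_derivative[where U = UNIV and f = "\<lambda>t y. u y * f (x + t *\<^sub>R v - y)"
      and fx = "\<lambda>t y. u y * f' (x + t *\<^sub>R v - y)"])
  fix t y
  have "((\<lambda>t. f ((x - y) + t *\<^sub>R v)) has_real_derivative f' ((x - y) + t *\<^sub>R v)) (at t)"
    by (rule deriv)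
  then show "((\<lambda>t. u y * f (x + t *\<^sub>R v - y)) has_real_derivative u y * f' (x + t *\<^sub>R v - y)) (at t)"
    by (intro DERIV_cmult) (simp add: algebra_simps)
next
  fix t
  show "(\<lambda>y. u y * f (x + t *\<^sub>R v - y)) integrable_on cbox a b"
    by (intro integrable_continuous continuous_intros continuous_on_subset[OF u]
        continuous_on_compose2[OF f]) auto
next
  show "continuous_on (UNIV \<times> cbox a b) (\<lambda>(t, y). u y * f' (x + t *\<^sub>R v - y))"
    unfolding case_prod_unfold
    by (intro continuous_intros continuous_on_compose2[OF u] continuous_on_compose2[OF f']) auto
qed auto

lemma continuous_on_convolution:
  fixes u :: "'a::euclidean_space \<Rightarrow> real" and f :: "'a \<Rightarrow> 'b::euclidean_space \<Rightarrow> real"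
  assumes u: "continuous_on UNIV u" and f: "continuous_on UNIV (\<lambda>(z, v). f z v)"
  shows "continuous_on UNIV (\<lambda>(x, v). integral (cbox a b) (\<lambda>y. u y * f (x - y) v))"
proof -
  have "continuous_on (UNIV \<times> cbox a b) (\<lambda>(p, y). u y * f (fst p - y) (snd p))"
    unfolding case_prod_unfold
    by (intro continuous_intros continuous_on_compose2[OF u]
        continuous_on_compose2[OF f, where f = "\<lambda>x. (fst (fst x) - snd x, snd (fst x))", simplified]) auto
  from integral_continuous_on_param[OF this] show ?thesis
    by (simp add: case_prod_unfold)
qed

text \<open>
  The convolution is taken over a compact set \<open>S\<close> (a box in what follows) rather than over the whole
  space, so that it can be differentiated under the integral sign. At a point whose \<open>e\<close>-neighbourhood
  lies in \<open>S\<close>, it is the ordinary convolution with \<open>bump e 3\<close>. The two further functions are its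
  first and second derivatives, as a linear and as a bilinear form.
\<close>

definition mollify :: "('a::euclidean_space) set \<Rightarrow> ('a \<Rightarrow> real) \<Rightarrow> real \<Rightarrow> 'a \<Rightarrow> real" where
  "mollify S u e x = integral S (\<lambda>y. u y * bump e 3 (x - y))"

definition mollify_gradient :: "('a::euclidean_space) set \<Rightarrow> ('a \<Rightarrow> real) \<Rightarrow> real \<Rightarrow> 'a \<Rightarrow> 'a \<Rightarrow> real" where
  "mollify_gradient S u e x v = integral S (\<lambda>y. u y * (- 6 * ((x - y) \<bullet> v) * bump e 2 (x - y)))"

definition mollify_hessian :: "('a::euclidean_space) set \<Rightarrow> ('a \<Rightarrow> real) \<Rightarrow> real \<Rightarrow> 'a \<Rightarrow> 'a \<Rightarrow> 'a \<Rightarrow> real" where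
  "mollify_hessian S u e x v w = integral S (\<lambda>y. u y *
     (24 * ((x - y) \<bullet> v) * ((x - y) \<bullet> w) * bump e 1 (x - y) - 6 * (v \<bullet> w) * bump e 2 (x - y)))"

context
  fixes u :: "'a::euclidean_space \<Rightarrow> real" and a b :: 'a
  assumes u: "continuous_on UNIV u"
begin

lemma mollify_line_derivative:
  "((\<lambda>t. mollify (cbox a b) u e (x + t *\<^sub>R v)) has_real_derivative
     mollify_gradient (cbox a b) u e (x + t *\<^sub>R v) v) (at t)"
  unfolding mollify_def mollify_gradient_def
proof (rule convolution_line_derivative[OF u, where f' = "\<lambda>z. - 6 * (z \<bullet> v) * bump e 2 z"])
  show "((\<lambda>t. bump e 3 (z + t *\<^sub>R v)) has_real_derivative
      - 6 * ((z + t *\<^sub>R v) \<bullet> v) * bump e 2 (z + t *\<^sub>R v)) (at t)" for z t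
    using bump_line_derivative[of 2 e z v t] by (simp add: eval_nat_numeral)
qed (intro continuous_intros)+

lemma mollify_gradient_line_derivative:
  "((\<lambda>t. mollify_gradient (cbox a b) u e (x + t *\<^sub>R v) v) has_real_derivative
     mollify_hessian (cbox a b) u e (x + t *\<^sub>R v) v v) (at t)"
  unfolding mollify_gradient_def mollify_hessian_def
proof (rule convolution_line_derivative[OF u, where f = "\<lambda>z. - 6 * (z \<bullet> v) * bump e 2 z"
      and f' = "\<lambda>z. 24 * (z \<bullet> v) * (z \<bullet> v) * bump e 1 z - 6 * (v \<bullet> v) * bump e 2 z"])
  show "((\<lambda>t. - 6 * ((z + t *\<^sub>R v) \<bullet> v) * bump e 2 (z + t *\<^sub>R v)) has_real_derivative
      24 * ((z + t *\<^sub>R v) \<bullet> v) * ((z + t *\<^sub>R v) \<bullet> v) * bump e 1 (z + t *\<^sub>R v)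
      - 6 * (v \<bullet> v) * bump e 2 (z + t *\<^sub>R v)) (at t)" for z t
  proof -
    have 1: "((\<lambda>t. - 6 * ((z + t *\<^sub>R v) \<bullet> v)) has_real_derivative - 6 * (v \<bullet> v)) (at t)"
      unfolding inner_add_left inner_scaleR_left by (auto intro!: derivative_eq_intros)
    have 2: "((\<lambda>t. bump e 2 (z + t *\<^sub>R v)) has_real_derivative
        - 4 * ((z + t *\<^sub>R v) \<bullet> v) * bump e 1 (z + t *\<^sub>R v)) (at t)"
      using bump_line_derivative[of 1 e z v t] by (simp add: eval_nat_numeral)
    show ?thesis
      by (rule DERIV_cong[OF DERIV_mult[OF 1 2]]) (simp add: algebra_simps)
  qed
qed (intro continuous_intros)+

lemma continuous_mollify: "continuous_on UNIV (mollify (cbox a b) u e)"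
proof -
  have "continuous_on UNIV (\<lambda>(x, v::real). integral (cbox a b) (\<lambda>y. u y * bump e 3 (x - y)))"
    by (rule continuous_on_convolution[OF u, where f = "\<lambda>z v. bump e 3 z"])
      (auto simp: case_prod_unfold intro!: continuous_intros)
  then have "continuous_on UNIV (\<lambda>x. (\<lambda>(x, v::real). integral (cbox a b) (\<lambda>y. u y * bump e 3 (x - y))) (x, 0))"
    by (rule continuous_on_compose2) (auto intro!: continuous_intros)
  then show ?thesis by (simp add: mollify_def[abs_def])
qed

lemma continuous_mollify_hessian:
  "continuous_on UNIV (\<lambda>(x, v). mollify_hessian (cbox a b) u e x v v)"
  unfolding mollify_hessian_def
  by (rule continuous_on_convolution[OF u, where f = "\<lambda>z v. 24 * (z \<bullet> v) * (z \<bullet> v) * bump e 1 z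
      - 6 * (v \<bullet> v) * bump e 2 z"])
    (auto simp: case_prod_unfold intro!: continuous_intros)

lemma linear_mollify_gradient: "linear (mollify_gradient (cbox a b) u e x)"
proof -
  have i: "(\<lambda>y. u y * (- 6 * ((x - y) \<bullet> v) * bump e 2 (x - y))) integrable_on cbox a b" for v
    by (intro integrable_continuous continuous_intros continuous_on_subset[OF u]) auto
  show ?thesis
  proof (rule linearI)
    fix v w :: 'a and c :: real
    show "mollify_gradient (cbox a b) u e x (v + w) = mollify_gradient (cbox a b) u e x v + mollify_gradient (cbox a b) u e x w"
      unfolding mollify_gradient_def integral_add[OF i i, symmetric] by (simp add: inner_add_right algebra_simps)
    show "mollify_gradient (cbox a b) u e x (c *\<^sub>R v) = c *\<^sub>R mollify_gradient (cbox a b) u e x v"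
      unfolding mollify_gradient_def real_scaleR_def integral_mult_right[symmetric]
      by (intro integral_cong) simp
  qed
qed

lemma bilinear_mollify_hessian: "bilinear (mollify_hessian (cbox a b) u e x)"
proof -
  let ?q = "\<lambda>v w y. 24 * ((x - y) \<bullet> v) * ((x - y) \<bullet> w) * bump e 1 (x - y)
    - 6 * (v \<bullet> w) * bump e 2 (x - y)"
  have i: "(\<lambda>y. u y * ?q v w y) integrable_on cbox a b" for v w
    by (intro integrable_continuous continuous_intros continuous_on_subset[OF u]) auto
  have sym: "mollify_hessian (cbox a b) u e x v w = mollify_hessian (cbox a b) u e x w v" for v w
    unfolding mollify_hessian_def by (simp add: inner_commute mult_ac)
  have lin: "linear (\<lambda>w. mollify_hessian (cbox a b) u e x v w)" for v
  proof (rule linearI)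
    fix w w' :: 'a and c :: real
    show "mollify_hessian (cbox a b) u e x v (w + w') = mollify_hessian (cbox a b) u e x v w + mollify_hessian (cbox a b) u e x v w'"
      unfolding mollify_hessian_def integral_add[OF i i, symmetric]
      by (intro integral_cong) (simp only: inner_add_right, simp add: algebra_simps)
    show "mollify_hessian (cbox a b) u e x v (c *\<^sub>R w) = c *\<^sub>R mollify_hessian (cbox a b) u e x v w"
      unfolding mollify_hessian_def real_scaleR_def integral_mult_right[symmetric]
      by (intro integral_cong) (simp only: inner_scaleR_right, simp add: algebra_simps)
  qed
  have "(\<lambda>v. mollify_hessian (cbox a b) u e x v w) = mollify_hessian (cbox a b) u e x w" for w
    using sym by auto
  then show ?thesis
    using lin unfolding bilinear_def by auto
qed

end

lemma mollify_eq_convolution: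
  fixes u :: "'a::euclidean_space \<Rightarrow> real"
  assumes u: "continuous_on UNIV u" and "e > 0" and sub: "ball x e \<subseteq> cbox a b"
  shows "mollify (cbox a b) u e x = (LINT y|lborel. bump e 3 y * u (x - y))"
proof -
  let ?f = "\<lambda>y. u y * bump e 3 (x - y)"
  have f: "continuous_on UNIV ?f"
    by (intro continuous_intros u)
  have "mollify (cbox a b) u e x = (LINT y:cbox a b|lborel. ?f y)"
    unfolding mollify_def set_integrable_def
    by (intro set_borel_integral_eq_integral(2)[symmetric])
      (auto simp: set_integrable_def intro!: borel_integrable_compact continuous_on_subset[OF f]
        simp del: real_scaleR_def)
  also have "\<dots> = (LINT y|lborel. ?f y)"
    unfolding set_lebesgue_integral_def
  proof (rule Bochner_Integration.integral_cong)
    fix y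
    have "?f y = 0" if "y \<notin> cbox a b"
      using that sub \<open>e > 0\<close> by (subst bump_eq_0) (auto simp: subset_iff dist_norm not_less)
    then show "indicator (cbox a b) y *\<^sub>R ?f y = ?f y"
      by (auto simp: indicator_def)
  qed simp
  also have "\<dots> = (LINT y|lborel. ?f (x + (-1) *\<^sub>R y))"
    using lborel_integral_affine[of ?f "-1" x] borel_measurable_continuous_onI[OF f] by simp
  finally show ?thesis by (simp add: mult.commute)
qed

lemma bump_le: "bump e k x \<le> (e\<^sup>2) ^ k"
  unfolding bump_def by (intro power_mono) auto

lemma integrable_bump_mult:
  fixes f :: "'a::euclidean_space \<Rightarrow> real"
  assumes "e > 0" "k \<ge> 1" "f \<in> borel_measurable borel" "\<And>y. norm y < e \<Longrightarrow> \<bar>f y\<bar> \<le> M"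
  shows "integrable lborel (\<lambda>y. bump e k y * f y)"
proof (rule integrableI_bounded_set[where A = "ball 0 e" and B = "(e\<^sup>2) ^ k * M"])
  have "bump e k \<in> borel_measurable (borel :: 'a measure)"
    by (intro borel_measurable_continuous_onI continuous_intros)
  then show "(\<lambda>y. bump e k y * f y) \<in> borel_measurable lborel"
    using assms(3) by simp
  show "AE y in lborel. y \<in> ball 0 e \<longrightarrow> norm (bump e k y * f y) \<le> (e\<^sup>2) ^ k * M"
    using assms(4) by (auto simp: abs_mult bump_nonneg intro!: mult_mono bump_le)
  show "AE y in lborel. y \<notin> ball 0 e \<longrightarrow> bump e k y * f y = 0"
    using assms(1,2) by (auto simp: bump_eq_0)
qed (simp_all add: emeasure_lborel_ball_finite[simplified])

lemma
  fixes u :: "'a::euclidean_space \<Rightarrow> real"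
  assumes u: "continuous_on UNIV u" and bound: "\<And>x. \<bar>u x\<bar> \<le> M" and "e > 0"
    and g [measurable]: "g \<in> borel_measurable borel"
  shows unit_ball_integral_convolution:
      "(LINT z:ball (0::'a) 1|lborel. (LINT y|lborel. bump e 3 y * u (x + g z - y))) =
       (LINT y|lborel. bump e 3 y * (LINT z:ball 0 1|lborel. u (x - y + g z)))"
    and integrable_bump_unit_ball_integral:
      "integrable lborel (\<lambda>y. bump e 3 y * (LINT z:ball (0::'a) 1|lborel. u (x - y + g z)))"
proof -
  define f where "f z y = indicator (ball 0 1) z * (bump e 3 y * u (x + g z - y))" for z y :: 'a
  have M: "M \<ge> 0" using bound[of 0] by linarith
  have [measurable]: "bump e 3 \<in> borel_measurable (borel :: 'a measure)"
    by (intro borel_measurable_continuous_onI continuous_intros)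
  have [measurable]: "u \<in> borel_measurable borel"
    by (intro borel_measurable_continuous_onI u)
  have [measurable]: "indicator (ball 0 1) \<in> borel_measurable (borel :: 'a measure)"
    by (rule borel_measurable_indicator) simp
  have int: "integrable (lborel \<Otimes>\<^sub>M lborel) (case_prod f)"
  proof (rule integrableI_bounded_set[where A = "ball 0 1 \<times> ball 0 e" and B = "(e\<^sup>2) ^ 3 * M"])
    show "case_prod f \<in> borel_measurable (lborel \<Otimes>\<^sub>M lborel)"
      unfolding f_def[abs_def] case_prod_unfold by measurable
    show "AE p in lborel \<Otimes>\<^sub>M lborel. p \<in> ball 0 1 \<times> ball 0 e \<longrightarrow> norm (case_prod f p) \<le> (e\<^sup>2) ^ 3 * M"
    proof (intro AE_I2 impI)
      fix p :: "'a \<times> 'a" assume "p \<in> ball 0 1 \<times> ball 0 e"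
      then have "norm (case_prod f p) = bump e 3 (snd p) * \<bar>u (x + g (fst p) - snd p)\<bar>"
        by (auto simp: f_def abs_mult bump_nonneg)
      also have "\<dots> \<le> (e\<^sup>2) ^ 3 * M"
        by (intro mult_mono bump_le bound) auto
      finally show "norm (case_prod f p) \<le> (e\<^sup>2) ^ 3 * M" .
    qed
    show "AE p in lborel \<Otimes>\<^sub>M lborel. p \<notin> ball 0 1 \<times> ball 0 e \<longrightarrow> case_prod f p = 0"
    proof (intro AE_I2 impI)
      fix p :: "'a \<times> 'a" assume "p \<notin> ball 0 1 \<times> ball 0 e"
      then have "norm (fst p) \<ge> 1 \<or> norm (snd p) \<ge> e"
        by (cases p) (auto simp: not_less)
      then show "case_prod f p = 0"
        using \<open>e > 0\<close> by (auto simp: f_def case_prod_unfold bump_eq_0)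
    qed
    show "emeasure (lborel \<Otimes>\<^sub>M lborel) (ball (0::'a) 1 \<times> ball (0::'a) e) < \<infinity>"
      using emeasure_lborel_ball_finite[of "0::'a" 1] emeasure_lborel_ball_finite[of "0::'a" e]
      by (subst lborel.emeasure_pair_measure_Times) (auto simp: ennreal_mult_less_top)
  qed auto
  have inner: "(LINT z|lborel. f z y) = bump e 3 y * (LINT z:ball 0 1|lborel. u (x - y + g z))" for y
  proof -
    have "f z y = bump e 3 y * (indicator (ball 0 1) z *\<^sub>R u (x - y + g z))" for z
      by (simp add: f_def algebra_simps)
    then show ?thesis
      by (simp add: set_lebesgue_integral_def)
  qed
  have outer: "(LINT y|lborel. f z y) =
      indicator (ball 0 1) z *\<^sub>R (LINT y|lborel. bump e 3 y * u (x + g z - y))" for z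
    by (simp add: f_def)
  from lborel_pair.Fubini_integral[OF int]
  show "(LINT z:ball (0::'a) 1|lborel. (LINT y|lborel. bump e 3 y * u (x + g z - y))) =
       (LINT y|lborel. bump e 3 y * (LINT z:ball 0 1|lborel. u (x - y + g z)))"
    unfolding inner outer by (simp add: set_lebesgue_integral_def)
  from lborel_pair.integrable_snd[OF int]
  show "integrable lborel (\<lambda>y. bump e 3 y * (LINT z:ball (0::'a) 1|lborel. u (x - y + g z)))"
    unfolding inner .
qed

text \<open>
  By Fubini's theorem, each side of the conclusion is the integral of the corresponding side of
  the hypothesis over the centres \<open>c = x - y\<close> with the nonnegative weight \<open>bump e 3 y\<close>.
\<close>

lemma mollify_average_inequality:
  fixes u :: "'a::euclidean_space \<Rightarrow> real"
  assumes u: "continuous_on UNIV u" and bound: "\<And>x. \<bar>u x\<bar> \<le> M" and "e > 0"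
    and \<kappa>: "0 < \<kappa>" "\<kappa> < 1" and "r > 0" and sub: "cball x (r + e) \<subseteq> cbox a b"
    and ineq: "\<And>c. c \<in> ball x e \<Longrightarrow> (LINT z:ball 0 1|lborel. u (c + (\<kappa> * r) *\<^sub>R sgn z))
      \<le> (LINT z:ball 0 1|lborel. u (c + r *\<^sub>R z))"
  shows "(LINT z:ball 0 1|lborel. mollify (cbox a b) u e (x + (\<kappa> * r) *\<^sub>R sgn z))
      \<le> (LINT z:ball 0 1|lborel. mollify (cbox a b) u e (x + r *\<^sub>R z))"
proof -
  have mollify: "(LINT z:ball 0 1|lborel. mollify (cbox a b) u e (x + g z)) =
      (LINT y|lborel. bump e 3 y * (LINT z:ball 0 1|lborel. u (x - y + g z)))"
    if g: "g \<in> borel_measurable borel" and le: "\<And>z. norm z < 1 \<Longrightarrow> norm (g z) \<le> r" for g :: "'a \<Rightarrow> 'a"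
  proof -
    have "ball (x + g z) e \<subseteq> cbox a b" if "norm z < 1" for z
    proof -
      have "ball (x + g z) e \<subseteq> cball x (r + e)"
      proof
        fix y assume "y \<in> ball (x + g z) e"
        then have "dist (x + g z) y < e" by simp
        moreover have "dist x (x + g z) \<le> r" using le[OF that] by (simp add: dist_norm)
        ultimately show "y \<in> cball x (r + e)"
          using dist_triangle[of x y "x + g z"] by simp
      qed
      then show ?thesis using sub by blast
    qed
    then have "indicator (ball 0 1) z *\<^sub>R mollify (cbox a b) u e (x + g z) =
        indicator (ball 0 1) z *\<^sub>R (LINT y|lborel. bump e 3 y * u (x + g z - y))" for z
      by (cases "norm z < 1") (simp_all add: mollify_eq_convolution[OF u \<open>e > 0\<close>])
    then show ?thesis
      unfolding unit_ball_integral_convolution[OF u bound \<open>e > 0\<close> g, symmetric]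
      by (simp only: set_lebesgue_integral_def)
  qed
  have g1: "(\<lambda>z. (\<kappa> * r) *\<^sub>R sgn z) \<in> borel_measurable (borel :: 'a measure)" by measurable
  have g2: "(\<lambda>z. r *\<^sub>R z) \<in> borel_measurable (borel :: 'a measure)" by measurable
  have le1: "norm ((\<kappa> * r) *\<^sub>R sgn z) \<le> r" for z :: 'a
    using \<kappa> \<open>r > 0\<close> by (simp add: norm_sgn)
  have le2: "norm (r *\<^sub>R z) \<le> r" if "norm z < 1" for z :: 'a
    using that \<open>r > 0\<close> by simp
  have "(LINT y|lborel. bump e 3 y * (LINT z:ball 0 1|lborel. u (x - y + (\<kappa> * r) *\<^sub>R sgn z)))
      \<le> (LINT y|lborel. bump e 3 y * (LINT z:ball 0 1|lborel. u (x - y + r *\<^sub>R z)))"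
  proof (rule Bochner_Integration.integral_mono)
    show "integrable lborel (\<lambda>y. bump e 3 y * (LINT z:ball 0 1|lborel. u (x - y + (\<kappa> * r) *\<^sub>R sgn z)))"
      by (rule integrable_bump_unit_ball_integral[OF u bound \<open>e > 0\<close> g1])
    show "integrable lborel (\<lambda>y. bump e 3 y * (LINT z:ball 0 1|lborel. u (x - y + r *\<^sub>R z)))"
      by (rule integrable_bump_unit_ball_integral[OF u bound \<open>e > 0\<close> g2])
    fix y :: 'a
    show "bump e 3 y * (LINT z:ball 0 1|lborel. u (x - y + (\<kappa> * r) *\<^sub>R sgn z))
      \<le> bump e 3 y * (LINT z:ball 0 1|lborel. u (x - y + r *\<^sub>R z))"
    proof (cases "norm y < e")
      case True
      then show ?thesis
        using ineq[of "x - y"] by (intro mult_left_mono bump_nonneg) (simp add: dist_norm)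
    next
      case False
      then show ?thesis using \<open>e > 0\<close> by (simp add: bump_eq_0)
    qed
  qed
  then show ?thesis
    using mollify[OF g1 le1] mollify[OF g2 le2] by simp
qed

lemma integral_bump_pos:
  assumes "e > 0"
  shows "(LINT y|lborel. bump e 3 (y::'a::euclidean_space)) > 0"
proof -
  let ?c = "(3 * e\<^sup>2 / 4) ^ 3"
  have "0 < ?c * measure lborel (ball (0::'a) (e / 2))"
    using assms by (intro mult_pos_pos) (auto simp: content_ball_pos)
  also have "\<dots> = (LINT y|lborel. ?c * indicator (ball (0::'a) (e / 2)) y)"
    by simp
  also have "\<dots> \<le> (LINT y|lborel. bump e 3 (y::'a))"
  proof (rule Bochner_Integration.integral_mono)
    show "integrable lborel (\<lambda>y. ?c * indicator (ball (0::'a) (e / 2)) y)"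
      by (intro integrable_mult_right integrable_real_indicator emeasure_lborel_ball_finite) simp
    show "integrable lborel (\<lambda>y::'a. bump e 3 y)"
      using integrable_bump_mult[of e 3 "\<lambda>_. 1" 1] assms by simp
    fix y :: 'a
    show "?c * indicator (ball 0 (e / 2)) y \<le> bump e 3 y"
    proof (cases "norm y < e / 2")
      case True
      then have "(norm y)\<^sup>2 \<le> (e / 2)\<^sup>2" by (intro power_mono) auto
      then have "3 * e\<^sup>2 / 4 \<le> e\<^sup>2 - y \<bullet> y"
        by (simp add: power2_norm_eq_inner power_divide)
      then have "3 * e\<^sup>2 / 4 \<le> max 0 (e\<^sup>2 - y \<bullet> y)"
        by (rule max.coboundedI2)
      then have "?c \<le> bump e 3 y" unfolding bump_def by (intro power_mono) auto
      then show ?thesis using True by simp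
    qed (simp add: bump_nonneg)
  qed
  finally show ?thesis .
qed

lemma mollify_approximates:
  fixes u :: "'a::euclidean_space \<Rightarrow> real"
  assumes u: "continuous_on UNIV u" and bound: "\<And>x. \<bar>u x\<bar> \<le> M" and "e > 0"
    and sub: "ball x e \<subseteq> cbox a b"
    and osc: "\<And>y. y \<in> ball x e \<Longrightarrow> \<bar>u y - u x\<bar> \<le> \<eta>"
  shows "\<bar>mollify (cbox a b) u e x / (LINT y|lborel. bump e 3 (y::'a)) - u x\<bar> \<le> \<eta>"
proof -
  let ?N = "LINT y|lborel. bump e 3 (y::'a)"
  have N: "?N > 0" by (rule integral_bump_pos[OF \<open>e > 0\<close>])
  have [measurable]: "u \<in> borel_measurable borel"
    by (intro borel_measurable_continuous_onI u)
  have i1: "integrable lborel (\<lambda>y. bump e 3 y * u (x - y))"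
    by (rule integrable_bump_mult[OF \<open>e > 0\<close>, where M=M]) (use bound in auto)
  have i2: "integrable lborel (\<lambda>y::'a. bump e 3 y * c)" for c
    by (rule integrable_bump_mult[OF \<open>e > 0\<close>, where M="\<bar>c\<bar>"]) auto
  have i3: "integrable lborel (\<lambda>y. bump e 3 y * \<bar>u (x - y) - u x\<bar>)"
    by (rule integrable_bump_mult[OF \<open>e > 0\<close>, where M=\<eta>]) (use osc in \<open>auto simp: dist_norm\<close>)
  have "mollify (cbox a b) u e x - u x * ?N = (LINT y|lborel. bump e 3 y * u (x - y) - bump e 3 y * u x)"
    unfolding mollify_eq_convolution[OF u \<open>e > 0\<close> sub] using i1 i2 by (simp add: mult.commute)
  also have "\<dots> = (LINT y|lborel. bump e 3 y * (u (x - y) - u x))"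
    by (simp add: right_diff_distrib)
  finally have "\<bar>mollify (cbox a b) u e x - u x * ?N\<bar> \<le> (LINT y|lborel. \<bar>bump e 3 y * (u (x - y) - u x)\<bar>)"
    by (simp only: integral_abs_bound)
  also have "\<dots> = (LINT y|lborel. bump e 3 y * \<bar>u (x - y) - u x\<bar>)"
    by (simp add: abs_mult bump_nonneg)
  also have "\<dots> \<le> (LINT y|lborel. bump e 3 (y::'a) * \<eta>)"
  proof (rule Bochner_Integration.integral_mono[OF i3 i2])
    fix y :: 'a
    show "bump e 3 y * \<bar>u (x - y) - u x\<bar> \<le> bump e 3 y * \<eta>"
    proof (cases "norm y < e")
      case True
      then show ?thesis
        using osc[of "x - y"] by (intro mult_left_mono bump_nonneg) (simp add: dist_norm)
    next
      case False
      then show ?thesis using \<open>e > 0\<close> by (simp add: bump_eq_0)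
    qed
  qed
  finally have "\<bar>mollify (cbox a b) u e x - u x * ?N\<bar> \<le> ?N * \<eta>" by simp
  moreover have "mollify (cbox a b) u e x / ?N - u x = (mollify (cbox a b) u e x - u x * ?N) / ?N"
    using N by (simp add: field_simps)
  ultimately show ?thesis
    using N by (simp add: pos_divide_le_eq mult.commute)
qed

section \<open>Comparison with harmonic functions\<close>

lemma second_derivative_nonpos_at_max:
  fixes w w' :: "real \<Rightarrow> real"
  assumes "d > 0"
    and w: "\<And>t. \<bar>t\<bar> < d \<Longrightarrow> (w has_real_derivative w' t) (at t)"
    and w': "(w' has_real_derivative c) (at 0)"
    and max: "\<And>t. \<bar>t\<bar> < d \<Longrightarrow> w t \<le> w 0"
  shows "c \<le> 0"
proof (rule ccontr)
  assume "\<not> c \<le> 0"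
  then obtain d' where d': "d' > 0" "\<And>h. 0 < h \<Longrightarrow> h < d' \<Longrightarrow> w' 0 < w' h"
    using has_real_derivative_pos_inc_right[OF w'] by auto
  have "w' 0 = 0"
    using w[of 0] \<open>d > 0\<close> max by (intro DERIV_local_max[of w "w' 0" 0 d]) auto
  define t where "t = min d d' / 2"
  have t: "0 < t" "t < d" "t < d'" using \<open>d > 0\<close> d'(1) by (auto simp: t_def)
  obtain s where s: "0 < s" "s < t" "w t - w 0 = (t - 0) * w' s"
    using MVT2[of 0 t w w'] t w by auto
  have "w' s > 0" using d'(2)[of s] s t \<open>w' 0 = 0\<close> by simp
  then have "w t - w 0 > 0" using s t by simp
  then show False using max[of t] t by simp
qed

lemma partial_deriv_line:
  assumes "f differentiable (at (x + t *\<^sub>R v))"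
  shows "((\<lambda>t. f (x + t *\<^sub>R v)) has_real_derivative partial_deriv v f (x + t *\<^sub>R v)) (at t)"
proof -
  have 1: "(f has_derivative frechet_derivative f (at (x + t *\<^sub>R v))) (at (x + t *\<^sub>R v))"
    using assms by (simp add: frechet_derivative_works)
  have 2: "((\<lambda>t. x + t *\<^sub>R v) has_derivative (\<lambda>h. h *\<^sub>R v)) (at t)"
    by (auto intro!: derivative_eq_intros)
  have "((\<lambda>t. f (x + t *\<^sub>R v)) has_derivative (\<lambda>h. frechet_derivative f (at (x + t *\<^sub>R v)) (h *\<^sub>R v))) (at t)"
    using diff_chain_at[OF 2 1] by (simp add: comp_def)
  moreover have "(\<lambda>h. frechet_derivative f (at (x + t *\<^sub>R v)) (h *\<^sub>R v)) =
      (*) (partial_deriv v f (x + t *\<^sub>R v))"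
    using linear_scale[OF linear_frechet_derivative[OF assms]] by (auto simp: partial_deriv_def)
  ultimately show ?thesis by (simp add: has_field_derivative_def)
qed

text \<open>
  The maximum principle. If \<open>U - h\<close> had an interior maximum after adding \<open>\<delta> |x - a|\<^sup>2\<close>, the second
  derivative test in each coordinate direction would bound the sum of the second derivatives there by
  \<open>0\<close>; but this sum is at least \<open>2 n \<delta>\<close>.
\<close>

lemma harmonic_comparison:
  fixes U h :: "'a::euclidean_space \<Rightarrow> real"
  assumes "r > 0"
    and D1: "\<And>x v t. ((\<lambda>t. U (x + t *\<^sub>R v)) has_real_derivative D (x + t *\<^sub>R v) v) (at t)"
    and D2: "\<And>x v t. ((\<lambda>t. D (x + t *\<^sub>R v) v) has_real_derivative Q (x + t *\<^sub>R v) v) (at t)"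
    and U: "continuous_on (cball a r) U"
    and Q: "\<And>x. x \<in> ball a r \<Longrightarrow> 0 \<le> (\<Sum>b\<in>Basis. Q x b)"
    and h: "harmonic_on h (ball a r)" "continuous_on (cball a r) h"
    and boundary: "\<And>x. x \<in> sphere a r \<Longrightarrow> U x \<le> h x + m"
    and x: "x \<in> cball a r"
  shows "U x \<le> h x + m"
proof (rule field_le_epsilon)
  fix \<epsilon> :: real assume "\<epsilon> > 0"
  \<comment> \<open>On the sphere the perturbation \<open>\<delta> |y - a|\<^sup>2\<close> then equals \<open>\<epsilon>\<close>.\<close>
  define \<delta> where "\<delta> = \<epsilon> / r\<^sup>2"
  have \<delta>: "\<delta> > 0" "\<delta> * r\<^sup>2 = \<epsilon>" using \<open>\<epsilon> > 0\<close> \<open>r > 0\<close> by (auto simp: \<delta>_def)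
  define w where "w = (\<lambda>y. U y - h y + \<delta> * ((y - a) \<bullet> (y - a)))"
  have "continuous_on (cball a r) w"
    unfolding w_def by (intro continuous_intros U h)
  then obtain p where p: "p \<in> cball a r" "\<And>y. y \<in> cball a r \<Longrightarrow> w y \<le> w p"
    using continuous_attains_sup[of "cball a r" w] \<open>r > 0\<close> by auto
  have "p \<notin> ball a r"
  proof
    assume pb: "p \<in> ball a r"
    define d where "d = r - dist a p"
    have d: "d > 0" using pb by (simp add: d_def)
    have in_ball: "p + t *\<^sub>R b \<in> ball a r" if "\<bar>t\<bar> < d" "b \<in> Basis" for t b
      using that dist_triangle[of a "p + t *\<^sub>R b" p] by (simp add: d_def dist_norm[of p])
    have "Q p b - partial_deriv b (partial_deriv b h) p + 2 * \<delta> \<le> 0" if b: "b \<in> Basis" for b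
    proof (rule second_derivative_nonpos_at_max[OF d])
      fix t :: real assume t: "\<bar>t\<bar> < d"
      have "h differentiable (at (p + t *\<^sub>R b))"
        using h(1) in_ball[OF t b] by (auto simp: harmonic_on_def C2_on_def)
      note hd = partial_deriv_line[OF this]
      have "((\<lambda>t. (p + t *\<^sub>R b - a) \<bullet> (p + t *\<^sub>R b - a)) has_real_derivative
          2 * ((p + t *\<^sub>R b - a) \<bullet> b)) (at t)"
        unfolding inner_add_left inner_add_right inner_diff_left inner_diff_right
          inner_scaleR_left inner_scaleR_right
        by (auto intro!: derivative_eq_intros simp: inner_commute algebra_simps)
      then show "((\<lambda>t. w (p + t *\<^sub>R b)) has_real_derivative
          D (p + t *\<^sub>R b) b - partial_deriv b h (p + t *\<^sub>R b) + \<delta> * (2 * ((p + t *\<^sub>R b - a) \<bullet> b))) (at t)"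
        unfolding w_def by (intro DERIV_add DERIV_diff DERIV_cmult D1 hd)
      show "w (p + t *\<^sub>R b) \<le> w (p + 0 *\<^sub>R b)"
        using p(2)[of "p + t *\<^sub>R b"] in_ball[OF t b] by simp
    next
      have "partial_deriv b h differentiable (at (p + 0 *\<^sub>R b))"
        using h(1) pb b by (auto simp: harmonic_on_def C2_on_def)
      note hd = partial_deriv_line[OF this]
      have "((\<lambda>t. (p + t *\<^sub>R b - a) \<bullet> b) has_real_derivative 1) (at 0)"
        unfolding inner_add_left inner_diff_left inner_scaleR_left using b
        by (auto intro!: derivative_eq_intros)
      then have "((\<lambda>t. D (p + t *\<^sub>R b) b - partial_deriv b h (p + t *\<^sub>R b)
          + \<delta> * (2 * ((p + t *\<^sub>R b - a) \<bullet> b))) has_real_derivative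
          Q (p + 0 *\<^sub>R b) b - partial_deriv b (partial_deriv b h) (p + 0 *\<^sub>R b) + \<delta> * (2 * 1)) (at 0)"
        by (intro DERIV_add DERIV_diff DERIV_cmult D2 hd)
      then show "((\<lambda>t. D (p + t *\<^sub>R b) b - partial_deriv b h (p + t *\<^sub>R b)
          + \<delta> * (2 * ((p + t *\<^sub>R b - a) \<bullet> b))) has_real_derivative
          Q p b - partial_deriv b (partial_deriv b h) p + 2 * \<delta>) (at 0)"
        by (simp add: mult.commute)
    qed
    then have "(\<Sum>b\<in>Basis. Q p b - partial_deriv b (partial_deriv b h) p + 2 * \<delta>) \<le> 0"
      by (rule sum_nonpos)
    moreover have "(\<Sum>b\<in>Basis. partial_deriv b (partial_deriv b h) p) = 0"
      using h(1) pb by (simp add: harmonic_on_def laplacian_def)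
    ultimately have "(\<Sum>b\<in>Basis. Q p b) + real DIM('a) * (2 * \<delta>) \<le> 0"
      by (simp add: sum.distrib sum_subtractf)
    moreover have "real DIM('a) * (2 * \<delta>) > 0" using \<delta> by simp
    ultimately show False using Q[OF pb] by linarith
  qed
  then have ps: "p \<in> sphere a r" using p(1) by auto
  then have "(p - a) \<bullet> (p - a) = r\<^sup>2"
    by (simp add: dist_norm norm_minus_commute flip: power2_norm_eq_inner)
  then have "w p \<le> m + \<epsilon>"
    using boundary[OF ps] \<delta> by (simp add: w_def)
  moreover have "U x - h x \<le> w x" using \<delta> by (simp add: w_def)
  ultimately show "U x \<le> h x + m + \<epsilon>" using p(2)[OF x] by linarith
qed

text \<open>
  Only the values of \<open>u\<close> in a compact neighbourhood \<open>K\<close> of \<open>A\<close> matter for averages over small balls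
  centred near \<open>A\<close>. Tietze's theorem replaces \<open>u\<close> by a bounded continuous function \<open>v\<close> on the whole
  space with the same values on \<open>K\<close>, and a normalised mollification of \<open>v\<close> is the approximant.
\<close>

lemma smooth_approximant:
  fixes u :: "'a::euclidean_space \<Rightarrow> real"
  assumes "open \<Omega>" and u: "continuous_on \<Omega> u" and A: "compact A" "A \<subseteq> \<Omega>"
    and \<kappa>: "0 < \<kappa>" "\<kappa> < 1" "\<kappa>\<^sup>2 < real DIM('a) / (real DIM('a) + 2)"
    and ineq: "\<And>a r. 0 < r \<Longrightarrow> cball a r \<subseteq> \<Omega> \<Longrightarrow> sphere_average u a (\<kappa> * r) \<le> ball_average u a r"
    and "\<eta> > 0"
  obtains U D Q where
    "\<And>x v t. ((\<lambda>t. U (x + t *\<^sub>R v)) has_real_derivative D (x + t *\<^sub>R v) v) (at t)"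
    "\<And>x v t. ((\<lambda>t. D (x + t *\<^sub>R v) v) has_real_derivative Q (x + t *\<^sub>R v) v) (at t)"
    "continuous_on UNIV U"
    "\<And>x. x \<in> A \<Longrightarrow> \<bar>U x - u x\<bar> \<le> \<eta>"
    "\<And>x. x \<in> A \<Longrightarrow> 0 \<le> (\<Sum>b\<in>Basis. Q x b)"
proof -
  obtain \<delta> where \<delta>: "\<delta> > 0" "(\<Union>x\<in>A. cball x \<delta>) \<subseteq> \<Omega>"
    using compact_subset_open_imp_cball_epsilon_subset[OF A(1) \<open>open \<Omega>\<close> A(2)] by blast
  define K where "K = (\<Union>y\<in>A. \<Union>z\<in>cball 0 \<delta>. {y + z})"
  have cK: "compact K"
    unfolding K_def by (rule compact_sums'[OF A(1) compact_cball])
  have inK: "z \<in> K" if "y \<in> A" "dist y z \<le> \<delta>" for y z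
  proof -
    have "z = y + (z - y)" "z - y \<in> cball 0 \<delta>"
      using that(2) by (auto simp: dist_norm norm_minus_commute)
    then show ?thesis using that(1) unfolding K_def by blast
  qed
  have K\<Omega>: "K \<subseteq> \<Omega>"
  proof
    fix x assume "x \<in> K"
    then obtain y z where "y \<in> A" "norm z \<le> \<delta>" "x = y + z" by (auto simp: K_def)
    then have "x \<in> cball y \<delta>" by (simp add: dist_norm)
    then show "x \<in> \<Omega>" using \<open>y \<in> A\<close> \<delta>(2) by blast
  qed
  have uK: "continuous_on K u" using u K\<Omega> by (rule continuous_on_subset)
  have "bounded (u ` K)"
    by (intro compact_imp_bounded compact_continuous_image uK cK)
  then obtain M0 where M0: "\<And>x. x \<in> K \<Longrightarrow> \<bar>u x\<bar> \<le> M0"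
    by (auto simp: bounded_iff)
  define M where "M = max 0 M0"
  have M: "M \<ge> 0" "\<And>x. x \<in> K \<Longrightarrow> norm (u x) \<le> M"
    using M0 by (auto simp: M_def intro: max.coboundedI2)
  obtain v where v: "continuous_on UNIV v" "\<And>x. x \<in> K \<Longrightarrow> v x = u x" "\<And>x. \<bar>v x\<bar> \<le> M"
    using Tietze[of K u UNIV M] uK M compact_imp_closed[OF cK] by auto
  obtain q where box: "K \<subseteq> cbox (-q) q"
    using bounded_subset_cbox_symmetric[OF compact_imp_bounded[OF cK]] by blast
  have "uniformly_continuous_on K v"
    by (intro compact_uniformly_continuous continuous_on_subset[OF v(1)] cK) auto
  then obtain \<epsilon> where \<epsilon>: "\<epsilon> > 0" "\<And>x y. x \<in> K \<Longrightarrow> y \<in> K \<Longrightarrow> dist y x < \<epsilon> \<Longrightarrow> \<bar>v y - v x\<bar> < \<eta>"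
    using \<open>\<eta> > 0\<close> unfolding uniformly_continuous_on_def dist_real_def by blast
  \<comment> \<open>Half of \<open>\<delta>\<close> is reserved for moving the centre by less than \<open>e\<close>, the other half for the radius \<open>r\<close>.\<close>
  define e where "e = min \<epsilon> (\<delta> / 2)"
  have e: "e > 0" "e \<le> \<epsilon>" "e \<le> \<delta> / 2" using \<epsilon>(1) \<delta>(1) by (auto simp: e_def)
  define N where "N = (LINT y|lborel. bump e 3 (y::'a))"
  have N: "N > 0" unfolding N_def by (rule integral_bump_pos[OF e(1)])
  let ?U = "mollify (cbox (-q) q) v e" and ?D = "mollify_gradient (cbox (-q) q) v e"
    and ?H = "mollify_hessian (cbox (-q) q) v e"
  have ball_K: "cball x \<delta> \<subseteq> K" if "x \<in> A" for x
    using inK[OF that] by auto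
  show thesis
  proof (rule that[of "\<lambda>x. ?U x / N" "\<lambda>x w. ?D x w / N" "\<lambda>x w. ?H x w w / N"])
    show "((\<lambda>t. ?U (x + t *\<^sub>R w) / N) has_real_derivative ?D (x + t *\<^sub>R w) w / N) (at t)" for x w t
      by (intro DERIV_cdivide mollify_line_derivative v(1))
    show "((\<lambda>t. ?D (x + t *\<^sub>R w) w / N) has_real_derivative ?H (x + t *\<^sub>R w) w w / N) (at t)" for x w t
      by (intro DERIV_cdivide mollify_gradient_line_derivative v(1))
    show "continuous_on UNIV (\<lambda>x. ?U x / N)"
      using N by (intro continuous_on_divide continuous_mollify v(1) continuous_on_const) auto
    show "\<bar>?U x / N - u x\<bar> \<le> \<eta>" if x: "x \<in> A" for x
    proof -
      have xK: "x \<in> K" using ball_K[OF x] \<delta>(1) by auto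
      have sub: "ball x e \<subseteq> K" using ball_K[OF x] e \<delta>(1) by (auto simp: subset_iff)
      have "\<bar>?U x / N - v x\<bar> \<le> \<eta>"
        unfolding N_def
      proof (rule mollify_approximates[OF v(1,3) e(1)])
        show "ball x e \<subseteq> cbox (-q) q" using sub box by blast
        show "\<bar>v y - v x\<bar> \<le> \<eta>" if "y \<in> ball x e" for y
          using \<epsilon>(2)[OF xK, of y] that sub e(2) by (force simp: dist_commute)
      qed
      then show ?thesis by (simp add: v(2)[OF xK])
    qed
    show "0 \<le> (\<Sum>b\<in>Basis. ?H x b b / N)" if x: "x \<in> A" for x
    proof -
      have avg: "(LINT z:ball 0 1|lborel. v (c + (\<kappa> * r) *\<^sub>R sgn z)) \<le> (LINT z:ball 0 1|lborel. v (c + r *\<^sub>R z))"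
        if r: "0 < r" "r < \<delta> / 2" and c: "c \<in> ball x e" for r c
      proof -
        have "cball c r \<subseteq> cball x \<delta>"
        proof
          fix y assume "y \<in> cball c r"
          then show "y \<in> cball x \<delta>" using dist_triangle[of x y c] c r e by simp
        qed
        then have cr: "cball c r \<subseteq> K" using ball_K[OF x] by blast
        have \<kappa>r: "\<kappa> * r \<le> r" "0 < \<kappa> * r" using \<kappa> r(1) by auto
        have in1: "c + (\<kappa> * r) *\<^sub>R sgn z \<in> K" for z
          using cr \<kappa>r r(1) by (auto simp: subset_iff dist_norm norm_sgn)
        have in2: "c + r *\<^sub>R z \<in> K" if "z \<in> ball 0 1" for z
          using cr r(1) that by (auto simp: subset_iff dist_norm)
        have "continuous_on (ball c r) u" "continuous_on (sphere c (\<kappa> * r)) u"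
          using cr \<kappa>r by (auto intro!: continuous_on_subset[OF uK])
        moreover have "sphere_average u c (\<kappa> * r) \<le> ball_average u c r"
          using cr K\<Omega> r(1) by (intro ineq) auto
        ultimately have "(LINT z:ball 0 1|lborel. u (c + (\<kappa> * r) *\<^sub>R sgn z))
            \<le> (LINT z:ball 0 1|lborel. u (c + r *\<^sub>R z))"
          using r(1) \<kappa>r by (simp add: sphere_average_eq ball_average_eq divide_right_mono_neg
              divide_le_cancel)
        moreover have "(LINT z:ball 0 1|lborel. u (c + (\<kappa> * r) *\<^sub>R sgn z)) =
            (LINT z:ball 0 1|lborel. v (c + (\<kappa> * r) *\<^sub>R sgn z))"
          by (simp add: v(2)[OF in1])
        moreover have "(LINT z:ball 0 1|lborel. u (c + r *\<^sub>R z)) = (LINT z:ball 0 1|lborel. v (c + r *\<^sub>R z))"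
          by (rule set_lebesgue_integral_cong) (auto simp: v(2)[OF in2])
        ultimately show ?thesis by simp
      qed
      have "0 \<le> (\<Sum>b\<in>Basis. ?H x b b)"
      proof (rule trace_nonneg_of_average_inequality[OF mollify_line_derivative[OF v(1)]
            mollify_gradient_line_derivative[OF v(1)] continuous_mollify_hessian[OF v(1)] continuous_mollify[OF v(1)]
            linear_mollify_gradient[OF v(1)] bilinear_mollify_hessian[OF v(1)] refl \<kappa>])
        show "\<delta> / 2 > 0" using \<delta>(1) by simp
        show "(LINT z:ball 0 1|lborel. ?U (x + (\<kappa> * r) *\<^sub>R sgn z)) \<le> (LINT z:ball 0 1|lborel. ?U (x + r *\<^sub>R z))"
          if r: "0 < r" "r < \<delta> / 2" for r
        proof (rule mollify_average_inequality[OF v(1,3) e(1) \<kappa>(1,2) r(1)])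
          have "cball x (r + e) \<subseteq> cball x \<delta>" using r e by (intro subset_cball) simp
          then show "cball x (r + e) \<subseteq> cbox (-q) q" using ball_K[OF x] box by blast
        qed (rule avg[OF r])
      qed
      then show ?thesis
        using N by (simp add: sum_divide_distrib[symmetric])
    qed
  qed
qed

text \<open>
  The argument works for all ratios below \<open>\<surd>(n / (n + 2))\<close>, the value at which the second-order terms
  of the two averages agree.
\<close>

theorem subharmonic_on_of_average_inequality:
  fixes u :: "'a::euclidean_space \<Rightarrow> real"
  assumes "open \<Omega>" and u: "continuous_on \<Omega> u"
    and \<kappa>: "0 < \<kappa>" "\<kappa> < 1" "\<kappa>\<^sup>2 < real DIM('a) / (real DIM('a) + 2)"
    and ineq: "\<And>a r. 0 < r \<Longrightarrow> cball a r \<subseteq> \<Omega> \<Longrightarrow> sphere_average u a (\<kappa> * r) \<le> ball_average u a r"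
  shows "subharmonic_on u \<Omega>"
  unfolding subharmonic_on_def
proof (intro conjI allI impI ballI)
  show "continuous_on \<Omega> u" by fact
next
  fix a r h x
  assume "0 < r \<and> cball a r \<subseteq> \<Omega> \<and> harmonic_on h (ball a r) \<and> continuous_on (cball a r) h \<and>
    (\<forall>x\<in>sphere a r. u x \<le> h x)"
  then have "r > 0" and sub: "cball a r \<subseteq> \<Omega>"
    and h: "harmonic_on h (ball a r)" "continuous_on (cball a r) h"
    and boundary: "\<And>x. x \<in> sphere a r \<Longrightarrow> u x \<le> h x" by auto
  assume x: "x \<in> ball a r"
  show "u x \<le> h x"
  proof (rule field_le_epsilon)
    fix \<epsilon> :: real assume "\<epsilon> > 0"
    then have "\<epsilon> / 2 > 0" by simp
    from smooth_approximant[OF \<open>open \<Omega>\<close> u compact_cball sub \<kappa> ineq this]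
    obtain U D Q where
      D1: "\<And>x v t. ((\<lambda>t. U (x + t *\<^sub>R v)) has_real_derivative D (x + t *\<^sub>R v) v) (at t)"
      and D2: "\<And>x v t. ((\<lambda>t. D (x + t *\<^sub>R v) v) has_real_derivative Q (x + t *\<^sub>R v) v) (at t)"
      and U: "continuous_on UNIV U"
      and approx: "\<And>x. x \<in> cball a r \<Longrightarrow> \<bar>U x - u x\<bar> \<le> \<epsilon> / 2"
      and Q: "\<And>x. x \<in> cball a r \<Longrightarrow> 0 \<le> (\<Sum>b\<in>Basis. Q x b)"
      by metis
    have "U x \<le> h x + \<epsilon> / 2"
    proof (rule harmonic_comparison[OF \<open>r > 0\<close> D1 D2 continuous_on_subset[OF U] _ h])
      show "U y \<le> h y + \<epsilon> / 2" if "y \<in> sphere a r" for y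
        using boundary[OF that] abs_le_D1[OF approx[of y]] that by simp
    qed (use x Q in auto)
    then show "u x \<le> h x + \<epsilon>"
      using abs_le_D2[OF approx[of x]] x by simp
  qed
qed

theorem theorem1p5:
  fixes u :: "real ^ 'n \<Rightarrow> real" and \<Omega> :: "(real ^ 'n) set" and \<kappa> :: real
  assumes "open \<Omega>" and "connected \<Omega>" and "\<Omega> \<noteq> {}"
    and "continuous_on \<Omega> u"
    and "0 < \<kappa>" and "\<kappa> \<le> kappa1 CARD('n)"
    and "\<And>a r. 0 < r \<Longrightarrow> cball a r \<subseteq> \<Omega> \<Longrightarrow> sphere_average u a (\<kappa> * r) \<le> ball_average u a r"
  shows "subharmonic_on u \<Omega>"
proof (rule subharmonic_on_of_average_inequality)
  show "\<kappa> < 1" "\<kappa>\<^sup>2 < real DIM(real ^ 'n) / (real DIM(real ^ 'n) + 2)"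
    using kappa1_square_bound[of "CARD('n)" \<kappa>] assms(5,6) by simp_all
qed (use assms in auto)

end
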